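(* Let $f,g,\phi\in\mathcal{A}$ with $g(z)\neq 0$ and $\phi(z)\neq 0$ for all $z\in\mathcal{U}\setminus\{0\}$. Let $\alpha,\beta,\gamma\in\mathbb{C}$ with $\Re\gamma>0$ and let $m\in\mathbb{R}_{+}$ with $m\geq 1$. If $$\frac{1-|z|^{(m+1)\Re\gamma}}{\Re\gamma}\left|\alpha\frac{zf''(z)}{f'(z)}+\beta\left(\frac{zg'(z)}{g(z)}-\frac{z\phi'(z)}{\phi(z)}\right)\right|\leq 1$$ holds for all $z\in\mathcal{U}$, then the function $\mathcal{F}_{\alpha,\beta,\gamma}$ defined by $$\mathcal{F}_{\alpha,\beta,\gamma}(z)=\left[\gamma\int_{0}^{z}u^{\gamma-1}\left(f'(u)\right)^{\alpha}\left(\frac{g(u)}{\phi(u)}\right)^{\beta}du\right]^{1/\gamma}$$ (principal branches) is analytic and univalent in $\mathcal{U}$.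
   Context: $\mathcal{U}=\{z\in\mathbb{C}:|z|<1\}$ is the open unit disk; $\mathcal{A}$ is the class of analytic functions $f$ in $\mathcal{U}$ with $f(0)=0$ and $f'(0)=1$; $\mathbb{R}_{+}$ is the set of positive real numbers. Univalent means injective. Expressions such as $zg'(z)/g(z)$ and $g(z)/\phi(z)$ are given their limit value $1$ at $z=0$. Branch convention: near the origin $h(u)=(f'(u))^{\alpha}(g(u)/\phi(u))^{\beta}$ is formed with principal branches (so $h$ is analytic near $0$ and $h(0)=1$). Then $\gamma\int_0^z u^{\gamma-1}h(u)\,du=z^{\gamma}h_2(z)$ with $h_2(z)=\gamma\int_0^1 t^{\gamma-1}h(tz)\,dt$ analytic near $0$, $h_2(0)=1$, and $\mathcal{F}_{\alpha,\beta,\gamma}(z)=z\,[h_2(z)]^{1/\gamma}$ with the principal branch near $0$. That $\mathcal{F}_{\alpha,\beta,\gamma}$ is analytic and univalent in $\mathcal{U}$ means that this function, defined near $0$, extends to an analytic injective function on $\mathcal{U}$. *)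

theory Defs
  imports "HOL-Complex_Analysis.Complex_Analysis"
begin

abbreviation unit_disk :: "complex set"
  where "unit_disk \<equiv> ball 0 1"

definition class_A :: "(complex \<Rightarrow> complex) set"
  where "class_A = {f. f analytic_on unit_disk \<and> f 0 = 0 \<and> deriv f 0 = 1}"

text \<open>
  For functions in the class both of the following expressions have a removable
  singularity at the origin, where they are given their limit value 1.
\<close>

definition z_log_deriv :: "(complex \<Rightarrow> complex) \<Rightarrow> complex \<Rightarrow> complex"
  where "z_log_deriv g z = (if z = 0 then 1 else z * deriv g z / g z)"

definition class_quot :: "(complex \<Rightarrow> complex) \<Rightarrow> (complex \<Rightarrow> complex) \<Rightarrow> complex \<Rightarrow> complex"
  where "class_quot g \<phi> z = (if z = 0 then 1 else g z / \<phi> z)"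

text \<open>
  The three functions below use principal branches throughout (complex \<open>powr\<close>), so
  they have the intended meaning in a sufficiently small neighbourhood of the origin
  only, where both bases of \<open>integrand_h\<close> and \<open>op_h2\<close> itself are close to 1.
\<close>

definition integrand_h ::
  "(complex \<Rightarrow> complex) \<Rightarrow> (complex \<Rightarrow> complex) \<Rightarrow> (complex \<Rightarrow> complex) \<Rightarrow> complex \<Rightarrow> complex
     \<Rightarrow> complex \<Rightarrow> complex"
  where "integrand_h f g \<phi> \<alpha> \<beta> u = (deriv f u) powr \<alpha> * (class_quot g \<phi> u) powr \<beta>"

text \<open>
  Substituting \<open>u = t * z\<close> gives
  \<open>\<gamma> * (integral of u powr (\<gamma> - 1) * h u over the segment from 0 to z) = z powr \<gamma> * op_h2 z\<close>,
  whose \<open>1/\<gamma>\<close>-th power is \<open>z * (op_h2 z) powr (1/\<gamma>)\<close>. This form avoids the branch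
  point of \<open>z powr \<gamma>\<close> at the origin.
\<close>

definition op_h2 ::
  "(complex \<Rightarrow> complex) \<Rightarrow> (complex \<Rightarrow> complex) \<Rightarrow> (complex \<Rightarrow> complex) \<Rightarrow> complex \<Rightarrow> complex
     \<Rightarrow> complex \<Rightarrow> complex \<Rightarrow> complex"
  where "op_h2 f g \<phi> \<alpha> \<beta> \<gamma> z =
    \<gamma> * integral {0..1} (\<lambda>t::real. of_real t powr (\<gamma> - 1) * integrand_h f g \<phi> \<alpha> \<beta> (of_real t * z))"

definition op_F ::
  "(complex \<Rightarrow> complex) \<Rightarrow> (complex \<Rightarrow> complex) \<Rightarrow> (complex \<Rightarrow> complex) \<Rightarrow> complex \<Rightarrow> complex
     \<Rightarrow> complex \<Rightarrow> complex \<Rightarrow> complex"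
  where "op_F f g \<phi> \<alpha> \<beta> \<gamma> z = z * (op_h2 f g \<phi> \<alpha> \<beta> \<gamma> z) powr (1 / \<gamma>)"

end

theory Submission
  imports Defs
begin

text \<open>
  The proof follows the method of Loewner chains, with the theory of the Loewner differential
  equation replaced by a first-collision argument.

  Let \<open>h\<close> be the analytic continuation to the disk of the integrand (without \<open>u powr (\<gamma> - 1)\<close>) and
  \<open>H\<close> that of \<open>op_h2\<close>; they are related by \<open>z H' + \<gamma> H = \<gamma> h\<close>
  (\<open>integral_eq_Euler_solution\<close>). The expression in the hypothesis is \<open>z h' / h\<close>, so the
  hypothesis for \<open>m \<ge> 1\<close> implies
  \<open>(1 - \<bar>z\<bar> powr (2 Re \<gamma>)) * \<bar>z h' / h\<bar> \<le> Re \<gamma>\<close>. For \<open>0 \<le> t \<le> 1\<close> put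
  \<open>s = t powr (2\<gamma>)\<close> and
  \<open>D (z, t) = s H (t z) + (1 - s) h (t z)\<close>, and let \<open>L (z, t) = (z / t) * D (z, t) powr (1 / \<gamma>)\<close>. At
  \<open>t = 1\<close> this is the function in question, and as \<open>t\<close> tends to 0, \<open>t L\<close> tends to the
  identity.

  A computation shows that \<open>t L\<^sub>t / (z L\<^sub>z) = - (\<gamma> - X) / (\<gamma> + X)\<close> with
  \<open>X = (1 - s) \<zeta> h'(\<zeta>) / h(\<zeta>)\<close> and \<open>\<zeta> = t z\<close>. The estimate
  \<open>\<bar>1 - s\<bar> \<le> \<bar>\<gamma>\<bar> / Re \<gamma> * (1 - t powr (2 Re \<gamma>))\<close> and the hypothesis give \<open>\<bar>X\<bar> < \<bar>\<gamma>\<bar>\<close> (in the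
  formal text \<open>X\<close> is multiplied by \<open>h(\<zeta>)\<close> to avoid the division; see \<open>norm_X_less\<close>), so the real
  part of the quotient is negative. Hence, if \<open>t\<close> decreases, the points where \<open>L\<close> takes a given
  value move towards the origin (\<open>backward_step_in_disk\<close>).

  Suppose now that \<open>L\<close> takes the same value at two points of \<open>cball 0 r\<close>, with \<open>r < 1\<close>, at some time.
  Local injectivity and compactness yield a smallest such time. It is not 0, because \<open>t L\<close> is linear
  there. So both points can be moved a little backwards in time without leaving \<open>cball 0 r\<close>, and
  there is an earlier collision: a contradiction (\<open>inj_on_chain\<close>). The same argument, applied
  beforehand to the zeros of \<open>D\<close>, shows that \<open>D\<close> has none (\<open>D_nz\<close>), so a global branch of the
  power exists on the contractible set \<open>ball 0 1 \<times> {0..1}\<close>.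
\<close>

section \<open>Integral means, the Euler equation and an exponential estimate\<close>

text \<open>
  The derivative of \<open>exp (- t w)\<close> has modulus \<open>\<bar>w\<bar> exp (- t Re w)\<close>, and integrating this over
  \<open>[0, c]\<close> gives the right-hand side. With \<open>w = 2\<gamma>\<close> this is the one place where a complex
  exponent is traded for its real part, at the price of the factor \<open>\<bar>\<gamma>\<bar> / Re \<gamma>\<close>.
\<close>

lemma norm_one_minus_exp_le:
  fixes w :: complex
  assumes w: "Re w > 0" and c: "c \<ge> 0"
  shows "norm (1 - exp (- (of_real c * w))) \<le> norm w / Re w * (1 - exp (- (c * Re w)))"
proof (cases "c = 0")
  case False
  define u where "u t = exp (- (of_real t * w))" for t :: real
  define v where "v t = - (norm w / Re w) * exp (- (t * Re w))" for t :: real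
  have "norm (u c - u 0) \<le> v c - v 0"
  proof (rule differentiable_bound_general)
    show "0 < c" using c False by simp
    show "continuous_on {0..c} u" "continuous_on {0..c} v"
      unfolding u_def v_def by (intro continuous_intros)+
    fix x :: real assume "0 < x" "x < c"
    show "(u has_vector_derivative - w * exp (- (of_real x * w))) (at x)"
      unfolding u_def
      by (rule has_vector_derivative_real_field[where f = "\<lambda>z. exp (- (z * w))"])
        (auto intro!: derivative_eq_intros)
    show "(v has_vector_derivative norm w * exp (- (x * Re w))) (at x)"
      unfolding v_def has_real_derivative_iff_has_vector_derivative[symmetric]
      using w by (auto intro!: derivative_eq_intros)
    show "norm (- w * exp (- (of_real x * w))) \<le> norm w * exp (- (x * Re w))"
      by (simp add: norm_mult)
  qed
  then show ?thesis
    by (simp add: u_def v_def norm_minus_commute algebra_simps)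
qed simp

text \<open>
  If \<open>h = \<Sum> a\<^sub>n z\<^sup>n\<close>, the coefficients of the solution have to be \<open>\<gamma> a\<^sub>n / (\<gamma> + n)\<close>. The denominators
  do not vanish, and the quotients are bounded because \<open>Re (\<gamma> + n) \<ge> Re \<gamma> > 0\<close>, so the
  radius of convergence is not diminished.
\<close>

lemma Euler_equation_solution_exists:
  fixes h :: "complex \<Rightarrow> complex"
  assumes h: "h holomorphic_on ball 0 1" and \<gamma>: "Re \<gamma> > 0"
  obtains H where "H holomorphic_on ball 0 1"
    "\<And>z. z \<in> ball 0 1 \<Longrightarrow> z * deriv H z + \<gamma> * H z = \<gamma> * h z"
proof -
  define a where "a n = (deriv ^^ n) h 0 / fact n" for n
  define b where "b n = \<gamma> / (\<gamma> + of_nat n) * a n" for n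
  have nz: "\<gamma> + of_nat n \<noteq> 0" for n
  proof
    assume "\<gamma> + of_nat n = 0"
    then have "Re (\<gamma> + of_nat n) = 0" by simp
    then show False using \<gamma> by simp
  qed
  have hs: "(\<lambda>n. a n * z ^ n) sums h z" if "norm z < 1" for z
    using holomorphic_power_series[OF h, of z] that by (simp add: a_def)
  have bnd: "norm (b n) \<le> norm \<gamma> / Re \<gamma> * norm (a n)" for n
  proof -
    have "Re \<gamma> \<le> Re (\<gamma> + of_nat n)" by simp
    also have "\<dots> \<le> norm (\<gamma> + of_nat n)" by (rule complex_Re_le_cmod)
    finally have "norm \<gamma> / norm (\<gamma> + of_nat n) \<le> norm \<gamma> / Re \<gamma>"
      using \<gamma> by (intro divide_left_mono mult_pos_pos) auto
    then show ?thesis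
      unfolding b_def norm_mult norm_divide by (rule mult_right_mono) simp
  qed
  have summ: "summable (\<lambda>n. b n * z ^ n)" if z: "norm z < 1" for z
  proof -
    obtain r where r: "norm z < r" "r < 1" using dense[OF z] by blast
    then have r0: "0 < r" using norm_ge_zero[of z] by linarith
    have "summable (\<lambda>n. norm (a n * z ^ n))"
      using hs[of "of_real r"] r r0
      by (intro powser_insidea[of a "of_real r" z]) (auto intro: sums_summable)
    then have "summable (\<lambda>n. norm \<gamma> / Re \<gamma> * norm (a n * z ^ n))"
      by (rule summable_mult)
    then show ?thesis
    proof (rule summable_comparison_test[rotated], intro exI allI impI)
      fix n show "norm (b n * z ^ n) \<le> norm \<gamma> / Re \<gamma> * norm (a n * z ^ n)"
        using mult_right_mono[OF bnd[of n], of "norm (z ^ n)"] by (simp add: norm_mult mult.assoc)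
    qed
  qed
  define H where "H z = (\<Sum>n. b n * z ^ n)" for z
  have dH: "(H has_field_derivative (\<Sum>n. diffs b n * z ^ n)) (at z)" if "norm z < 1" for z
    unfolding H_def by (rule termdiffs_strong'[OF summ that])
  show ?thesis
  proof
    show "H holomorphic_on ball 0 1"
      unfolding holomorphic_on_open[OF open_ball] using dH by (meson mem_ball_0)
    fix z :: complex assume "z \<in> ball 0 1"
    then have z: "norm z < 1" by simp
    obtain r where r: "norm z < r" "r < 1" using dense[OF z] by blast
    have "(\<lambda>n. diffs b n * z ^ n) sums (\<Sum>n. diffs b n * z ^ n)"
      using r by (intro summable_sums termdiff_converges[of z 1 b] z summ) auto
    then have "(\<lambda>n. diffs b n * z ^ n) sums deriv H z"
      using DERIV_imp_deriv[OF dH[OF z]] by simp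
    then have "(\<lambda>n. z * (diffs b n * z ^ n)) sums (z * deriv H z)"
      by (rule sums_mult)
    then have "(\<lambda>n. of_nat (Suc n) * b (Suc n) * z ^ Suc n) sums (z * deriv H z)"
      by (simp add: diffs_def mult_ac)
    then have "(\<lambda>n. of_nat n * b n * z ^ n) sums (z * deriv H z)"
      using sums_Suc_iff[of "\<lambda>n. of_nat n * b n * z ^ n"] by simp
    moreover have "(\<lambda>n. \<gamma> * (b n * z ^ n)) sums (\<gamma> * H z)"
      unfolding H_def by (intro sums_mult summable_sums summ z)
    ultimately have "(\<lambda>n. of_nat n * b n * z ^ n + \<gamma> * (b n * z ^ n)) sums (z * deriv H z + \<gamma> * H z)"
      by (rule sums_add)
    moreover have "of_nat n * b n * z ^ n + \<gamma> * (b n * z ^ n) = \<gamma> * (a n * z ^ n)" for n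
    proof -
      have "(\<gamma> + of_nat n) * b n = \<gamma> * a n"
        using nz[of n] by (simp add: b_def)
      then have "(\<gamma> + of_nat n) * b n * z ^ n = \<gamma> * a n * z ^ n"
        by simp
      then show ?thesis by (simp add: algebra_simps)
    qed
    ultimately have "(\<lambda>n. \<gamma> * (a n * z ^ n)) sums (z * deriv H z + \<gamma> * H z)"
      by simp
    moreover have "(\<lambda>n. \<gamma> * (a n * z ^ n)) sums (\<gamma> * h z)"
      by (intro sums_mult hs z)
    ultimately show "z * deriv H z + \<gamma> * H z = \<gamma> * h z"
      by (rule sums_unique2)
  qed
qed

text \<open>
  The Euler equation says that \<open>t powr \<gamma> * H (t z)\<close> is a primitive of the integrand. The primitive
  is continuous up to \<open>t = 0\<close> since \<open>Re \<gamma> > 0\<close>, although the integrand may blow up there.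
\<close>

lemma integral_eq_Euler_solution:
  fixes h H :: "complex \<Rightarrow> complex"
  assumes H: "H holomorphic_on ball 0 1" and \<gamma>: "Re \<gamma> > 0"
    and eq: "\<And>z. z \<in> ball 0 1 \<Longrightarrow> z * deriv H z + \<gamma> * H z = \<gamma> * h z"
    and z: "z \<in> ball 0 1"
  shows "\<gamma> * integral {0..1} (\<lambda>t::real. of_real t powr (\<gamma> - 1) * h (of_real t * z)) = H z"
proof -
  have g0: "\<gamma> \<noteq> 0" using \<gamma> by auto
  have inb: "of_real t * z \<in> ball 0 1" if "0 \<le> t" "t \<le> 1" for t :: real
    using mult_left_le_one_le[of "norm z" t] that z by (simp add: norm_mult)
  have "((\<lambda>t::real. \<gamma> * (of_real t powr (\<gamma> - 1) * h (of_real t * z))) has_integral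
      (of_real 1 powr \<gamma> * H (of_real 1 * z) - of_real 0 powr \<gamma> * H (of_real 0 * z))) {0..1}"
  proof (rule fundamental_theorem_of_calculus_interior)
    have "continuous_on {0..1} (\<lambda>t::real. H (of_real t * z))"
      by (rule continuous_on_compose2[OF holomorphic_on_imp_continuous_on[OF H]])
        (use inb in \<open>auto intro!: continuous_intros simp: norm_mult\<close>)
    then show "continuous_on {0..1} (\<lambda>t::real. of_real t powr \<gamma> * H (of_real t * z))"
      using \<gamma> by (intro continuous_intros) auto
    fix t :: real assume t: "t \<in> {0<..<1}"
    let ?\<zeta> = "of_real t * z"
    have "(H has_field_derivative deriv H ?\<zeta>) (at ?\<zeta>)"
      using holomorphic_derivI[OF H open_ball inb[of t]] t by simp
    then have "((\<lambda>x. x powr \<gamma> * H (x * z)) has_field_derivative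
        (\<gamma> * of_real t powr (\<gamma> - 1) * H ?\<zeta> + deriv H ?\<zeta> * z * of_real t powr \<gamma>)) (at (of_real t))"
      using t by (auto intro!: derivative_eq_intros DERIV_chain2[of H] simp: complex_nonpos_Reals_iff)
    then have d: "((\<lambda>x::real. of_real x powr \<gamma> * H (of_real x * z)) has_vector_derivative
        (\<gamma> * of_real t powr (\<gamma> - 1) * H ?\<zeta> + deriv H ?\<zeta> * z * of_real t powr \<gamma>)) (at t)"
      by (rule has_vector_derivative_real_field)
    have "of_real t powr \<gamma> = of_real t powr (\<gamma> - 1) * of_real t"
      using t powr_add[of "of_real t" "\<gamma> - 1" 1] by simp
    then have "\<gamma> * of_real t powr (\<gamma> - 1) * H ?\<zeta> + deriv H ?\<zeta> * z * of_real t powr \<gamma>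
        = of_real t powr (\<gamma> - 1) * (?\<zeta> * deriv H ?\<zeta> + \<gamma> * H ?\<zeta>)"
      by (simp add: algebra_simps)
    also have "\<dots> = \<gamma> * (of_real t powr (\<gamma> - 1) * h ?\<zeta>)"
      using eq[OF inb[of t]] t by (simp add: algebra_simps)
    finally show "((\<lambda>x::real. of_real x powr \<gamma> * H (of_real x * z)) has_vector_derivative
        \<gamma> * (of_real t powr (\<gamma> - 1) * h ?\<zeta>)) (at t)"
      using d by simp
  qed simp
  then have "((\<lambda>t::real. \<gamma> * (of_real t powr (\<gamma> - 1) * h (of_real t * z))) has_integral H z) {0..1}"
    by simp
  then have "integral {0..1} (\<lambda>t::real. \<gamma> * (of_real t powr (\<gamma> - 1) * h (of_real t * z))) = H z"
    by (rule integral_unique)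
  then show ?thesis by simp
qed

section \<open>Level sets and continuous logarithms\<close>

text \<open>
  Along a level set of \<open>\<Psi>\<close>, decreasing time by \<open>e\<close> moves the point \<open>z\<close> by about \<open>e b / a\<close>. The
  hypothesis on \<open>cnj z * (b / a)\<close> says that this motion points into the disk of radius \<open>\<bar>z\<bar>\<close>, so a
  nearby solution at time \<open>\<tau> - e\<close> exists without leaving \<open>cball 0 r\<close>, even when \<open>z\<close> is on
  its boundary. One such step replaces the flow of the Loewner differential equation.
  The solution is found by Brouwer's theorem and not by the implicit function theorem, which is why
  continuity and differentiability at the single point \<open>(z, \<tau>)\<close> are enough.
\<close>

lemma backward_step_in_disk:
  fixes \<Psi> :: "complex \<times> real \<Rightarrow> complex"
  assumes cont: "continuous_on (ball 0 1 \<times> {0<..1}) \<Psi>"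
    and der: "(\<Psi> has_derivative (\<lambda>v. a * fst v + of_real (snd v) * b))
               (at (z, \<tau>) within ball 0 1 \<times> {0..1})"
    and a: "a \<noteq> 0" and dir: "Re (cnj z * (b / a)) < 0"
    and z: "norm z \<le> r" and r: "r < 1" and \<tau>: "0 < \<tau>" "\<tau> \<le> 1" and \<delta>: "\<delta> > 0"
  shows "\<exists>e0>0. \<forall>e. 0 < e \<and> e < e0 \<longrightarrow>
           (\<exists>z'. norm z' \<le> r \<and> dist z' z < \<delta> \<and> \<Psi> (z', \<tau> - e) = \<Psi> (z, \<tau>))"
proof -
  define p where "p = b / a"
  define \<kappa> where "\<kappa> = - Re (cnj z * p)"
  have \<kappa>: "\<kappa> > 0" using dir by (simp add: \<kappa>_def p_def)
  have r0: "0 \<le> r" using z norm_ge_zero[of z] by linarith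
  \<comment> \<open>Points \<open>z + e (p + u)\<close> with \<open>\<bar>u\<bar> \<le> c\<close> still move inward, so the correction \<open>u\<close> may be as large as \<open>c\<close>.\<close>
  define c where "c = \<kappa> / 2"
  have c: "c > 0" using \<kappa> by (simp add: c_def)
  define M where "M = norm p + c"
  have M: "M > 0" using c by (simp add: M_def add_nonneg_pos)
  \<comment> \<open>Accuracy of the linearisation that keeps the error of one step below \<open>e c \<bar>a\<bar>\<close>; the step has length at most \<open>e (M + 1)\<close>.\<close>
  define \<eta> where "\<eta> = c * norm a / (M + 1)"
  have \<eta>: "\<eta> > 0" using a c M by (simp add: \<eta>_def)
  obtain d where d: "d > 0" and dbound: "\<And>y. y \<in> ball 0 1 \<times> {0..1} \<Longrightarrow> norm (y - (z, \<tau>)) < d \<Longrightarrow>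
      norm (\<Psi> y - \<Psi> (z, \<tau>) - (a * fst (y - (z, \<tau>)) + of_real (snd (y - (z, \<tau>))) * b))
        \<le> \<eta> * norm (y - (z, \<tau>))"
    using der \<eta> unfolding has_derivative_within_alt by blast
  define e0 where "e0 = Min {\<tau>, d / (M + 1), \<delta> / M, \<kappa> / M\<^sup>2}"
  have e0: "e0 > 0" using \<tau> d M \<delta> \<kappa> by (simp add: e0_def)
  have "\<exists>z'. norm z' \<le> r \<and> dist z' z < \<delta> \<and> \<Psi> (z', \<tau> - e) = \<Psi> (z, \<tau>)" if e: "0 < e" "e < e0" for e
  proof -
    have e1: "e < \<tau>" "e * (M + 1) < d" "e * M < \<delta>" "e * M\<^sup>2 < \<kappa>"
      using e M by (auto simp: e0_def field_simps)
    define y where "y u = z + of_real e * (p + u)" for u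
    have normpu: "norm (p + u) \<le> M" if "u \<in> cball 0 c" for u
      using that norm_triangle_ineq[of p u] by (simp add: M_def)
    have yr: "norm (y u) \<le> r" if u: "u \<in> cball 0 c" for u
    proof -
      have "Re (cnj z * u) \<le> norm (cnj z * u)" by (rule complex_Re_le_cmod)
      also have "\<dots> \<le> 1 * c"
        unfolding norm_mult using u z r by (intro mult_mono) auto
      finally have 1: "Re (cnj z * (p + u)) \<le> - \<kappa> / 2"
        using \<kappa>_def by (simp add: c_def algebra_simps)
      have "(norm (y u))\<^sup>2 = (norm z)\<^sup>2 + 2 * e * Re (cnj z * (p + u)) + e\<^sup>2 * (norm (p + u))\<^sup>2"
        unfolding y_def cmod_power2 by (simp add: power2_eq_square algebra_simps)
      also have "\<dots> \<le> r\<^sup>2 + 2 * e * (- \<kappa> / 2) + e\<^sup>2 * M\<^sup>2"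
        using 1 e z by (intro add_mono mult_left_mono power_mono normpu[OF u]) auto
      also have "\<dots> = r\<^sup>2 + e * (e * M\<^sup>2 - \<kappa>)"
        by (simp add: power2_eq_square algebra_simps)
      also have "\<dots> \<le> r\<^sup>2"
        using e e1 by (simp add: mult_nonneg_nonpos)
      finally show ?thesis using r0 by (rule power2_le_imp_le)
    qed
    have yz: "norm (y u - z) \<le> e * M" if u: "u \<in> cball 0 c" for u
      using normpu[OF u] e by (simp add: y_def norm_mult)
    have step: "norm (\<Psi> (y u, \<tau> - e) - \<Psi> (z, \<tau>) - a * of_real e * u) \<le> e * (c * norm a)"
      if u: "u \<in> cball 0 c" for u
    proof -
      have n: "norm ((y u, \<tau> - e) - (z, \<tau>)) \<le> e * (M + 1)"
        using norm_Pair_le[of "y u - z" "- e"] yz[OF u] e by (simp add: algebra_simps)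
      have "norm (\<Psi> (y u, \<tau> - e) - \<Psi> (z, \<tau>) - (a * (y u - z) + of_real (- e) * b))
          \<le> \<eta> * norm ((y u, \<tau> - e) - (z, \<tau>))"
        using dbound[of "(y u, \<tau> - e)"] n yr[OF u] r e e1 \<tau> by simp
      also have "\<dots> \<le> \<eta> * (e * (M + 1))"
        using n \<eta> by (intro mult_left_mono) auto
      also have "\<dots> = e * (c * norm a)"
        using M by (simp add: \<eta>_def)
      also have "a * (y u - z) + of_real (- e) * b = a * of_real e * u"
        using a by (simp add: y_def p_def field_simps)
      finally show ?thesis .
    qed
    \<comment> \<open>A fixed point of this Newton-type map is a solution at time \<open>\<tau> - e\<close>.\<close>
    define T where "T u = u - (\<Psi> (y u, \<tau> - e) - \<Psi> (z, \<tau>)) / (a * of_real e)" for u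
    have "continuous_on (cball 0 c) (\<lambda>u. \<Psi> (y u, \<tau> - e))"
    proof (rule continuous_on_compose2[OF cont])
      show "continuous_on (cball 0 c) (\<lambda>u. (y u, \<tau> - e))"
        unfolding y_def by (intro continuous_intros)
      show "(\<lambda>u. (y u, \<tau> - e)) ` cball 0 c \<subseteq> ball 0 1 \<times> {0<..1}"
        using yr r e e1 \<tau> by fastforce
    qed
    then have "continuous_on (cball 0 c) T"
      unfolding T_def using a e by (intro continuous_intros) auto
    moreover have "T \<in> cball 0 c \<rightarrow> cball 0 c"
    proof
      fix u :: complex assume u: "u \<in> cball 0 c"
      have "T u = - ((\<Psi> (y u, \<tau> - e) - \<Psi> (z, \<tau>) - a * of_real e * u) / (a * of_real e))"
        using a e by (simp add: T_def field_simps)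
      then have "norm (T u) = norm (\<Psi> (y u, \<tau> - e) - \<Psi> (z, \<tau>) - a * of_real e * u) / (norm a * e)"
        using e by (simp add: norm_divide norm_mult)
      also have "\<dots> \<le> e * (c * norm a) / (norm a * e)"
        using step[OF u] a e by (intro divide_right_mono) auto
      also have "\<dots> = c" using a e by simp
      finally show "T u \<in> cball 0 c" by simp
    qed
    ultimately obtain u :: complex where u: "u \<in> cball 0 c" "T u = u"
      using brouwer[of "cball 0 c" T] c by auto
    then have "\<Psi> (y u, \<tau> - e) = \<Psi> (z, \<tau>)"
      using a e by (simp add: T_def)
    moreover have "dist (y u) z < \<delta>"
      using yz[OF u(1)] e1 by (simp add: dist_norm)
    ultimately show ?thesis using yr[OF u(1)] by blast
  qed
  then show ?thesis using e0 by blast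
qed

text \<open>
  Near \<open>x\<close> the function \<open>\<Lambda>\<close> differs from \<open>\<Lambda> x\<close> by less than \<open>1 < pi\<close>, hence equals
  \<open>\<Lambda> x + Ln (D y / D x)\<close> there: a continuous branch of the logarithm is as smooth as \<open>D\<close>.
\<close>

lemma has_derivative_continuous_log:
  fixes \<Lambda> D :: "'a::real_normed_vector \<Rightarrow> complex"
  assumes cont: "continuous_on S \<Lambda>" and expD: "\<And>x. x \<in> S \<Longrightarrow> exp (\<Lambda> x) = D x"
    and x: "x \<in> S" and der: "(D has_derivative D') (at x within S)"
  shows "(\<Lambda> has_derivative (\<lambda>v. D' v / D x)) (at x within S)"
proof -
  have D0: "D x \<noteq> 0" using expD[OF x] by (metis exp_not_eq_zero)
  obtain d where d: "d > 0" and close: "\<And>y. y \<in> S \<Longrightarrow> dist y x < d \<Longrightarrow> dist (\<Lambda> y) (\<Lambda> x) < 1"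
    using cont x unfolding continuous_on_iff by (meson zero_less_one)
  have "(Ln has_derivative (*) (inverse (D x / D x))) (at (D x / D x))"
    using has_field_derivative_Ln[of "D x / D x"] D0 by (simp add: has_field_derivative_def)
  moreover have "((\<lambda>y. D y / D x) has_derivative (\<lambda>v. D' v / D x)) (at x within S)"
    using der by (auto intro!: derivative_eq_intros simp: D0 field_simps)
  ultimately have "((\<lambda>y. Ln (D y / D x)) has_derivative
      (\<lambda>v. inverse (D x / D x) * (D' v / D x))) (at x within S)"
    by (rule has_derivative_compose[rotated])
  then have "((\<lambda>y. \<Lambda> x + Ln (D y / D x)) has_derivative (\<lambda>v. D' v / D x)) (at x within S)"
    using D0 by (auto intro!: derivative_eq_intros)
  then show ?thesis
  proof (rule has_derivative_transform_within[OF _ d x])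
    fix y assume y: "y \<in> S" "dist y x < d"
    have "\<bar>Im (\<Lambda> y - \<Lambda> x)\<bar> < 1"
      using close[OF y] abs_Im_le_cmod[of "\<Lambda> y - \<Lambda> x"] by (simp add: dist_norm)
    then have "Ln (exp (\<Lambda> y - \<Lambda> x)) = \<Lambda> y - \<Lambda> x"
      using pi_gt3 by (intro Ln_exp) auto
    then show "\<Lambda> x + Ln (D y / D x) = \<Lambda> y"
      using expD[OF y(1)] expD[OF x] by (simp add: exp_diff)
  qed
qed

section \<open>The Loewner chain of an Euler pair\<close>

lemma Re_Cayley_neg:
  fixes A X :: complex
  assumes "norm X < norm A"
  shows "Re ((X - A) / (A + X)) < 0"
proof -
  have nz: "A + X \<noteq> 0"
  proof
    assume "A + X = 0"
    then have "A = - X" by (simp add: eq_neg_iff_add_eq_0)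
    then show False using assms by simp
  qed
  have "(X - A) * cnj (A + X) = (X * cnj X - A * cnj A) + (X * cnj A - cnj (X * cnj A))"
    by (simp add: algebra_simps)
  moreover have "Re (X * cnj X - A * cnj A) = (norm X)\<^sup>2 - (norm A)\<^sup>2"
    unfolding cmod_power2 by (simp add: power2_eq_square)
  moreover have "Re (X * cnj A - cnj (X * cnj A)) = 0" by simp
  ultimately have "Re ((X - A) * cnj (A + X)) = (norm X)\<^sup>2 - (norm A)\<^sup>2"
    by (simp only: plus_complex.sel)
  also have "\<dots> < 0"
    using assms by (simp add: power_strict_mono)
  finally show ?thesis
    using nz by (simp add: Re_complex_div_lt_0)
qed

text \<open>
  The analytic core of the criterion: \<open>h\<close> stands for the integrand (without the power of \<open>u\<close>) and
  \<open>H\<close> for the integral mean, so that \<open>z powr \<gamma> * H(z)\<close> is \<open>\<gamma>\<close> times the integral of \<open>u powr (\<gamma> - 1) * h(u)\<close>.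
  The damping condition is the case \<open>m = 1\<close> of the hypothesis of the theorem.
\<close>

locale damped_Euler_pair =
  fixes h H :: "complex \<Rightarrow> complex" and \<gamma> :: complex
  assumes h_holo: "h holomorphic_on ball 0 1" and H_holo: "H holomorphic_on ball 0 1"
    and Re_gamma: "Re \<gamma> > 0"
    and h_nz: "z \<in> ball 0 1 \<Longrightarrow> h z \<noteq> 0" and h_0: "h 0 = 1"
    and Euler_eq: "z \<in> ball 0 1 \<Longrightarrow> z * deriv H z + \<gamma> * H z = \<gamma> * h z"
    and damping: "z \<in> ball 0 1 \<Longrightarrow>
      (1 - norm z powr (2 * Re \<gamma>)) * norm (z * deriv h z) \<le> Re \<gamma> * norm (h z)"
begin

text \<open>
  In the usual Loewner parameter \<open>\<theta> = - ln t\<close> the chain is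
  \<open>L (z, \<theta>) = exp \<theta> * z * D(z) powr (1 / \<gamma>)\<close>. Using \<open>t\<close> itself as time turns the limit
  \<open>\<theta> \<rightarrow> \<infinity>\<close> into the ordinary point \<open>t = 0\<close>, where \<open>D\<close> is constantly 1, so that all compactness
  arguments take place on \<open>cball 0 r \<times> {0..1}\<close>. The functions \<open>Dz\<close> and \<open>Dt\<close> are the two partial
  derivatives of \<open>D\<close>; the form of \<open>Dt\<close> already incorporates the Euler equation.
\<close>

definition s :: "real \<Rightarrow> complex" where "s t = of_real t powr (2 * \<gamma>)"

definition D :: "complex \<Rightarrow> real \<Rightarrow> complex" where
  "D z t = s t * H (of_real t * z) + (1 - s t) * h (of_real t * z)"

definition X :: "complex \<Rightarrow> real \<Rightarrow> complex" where
  "X z t = (1 - s t) * (of_real t * z * deriv h (of_real t * z))"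

definition Dz :: "complex \<Rightarrow> real \<Rightarrow> complex" where
  "Dz z t = of_real t * (s t * deriv H (of_real t * z) + (1 - s t) * deriv h (of_real t * z))"

definition Dt :: "complex \<Rightarrow> real \<Rightarrow> complex" where
  "Dt z t = (2 * X z t - z * Dz z t) / of_real t"

lemma gamma_nz: "\<gamma> \<noteq> 0"
  using Re_gamma by auto

lemma s_0 [simp]: "s 0 = 0" and s_1 [simp]: "s 1 = 1"
  by (simp_all add: s_def)

lemma continuous_on_s: "continuous_on {0..1} s"
  unfolding s_def using Re_gamma by (intro continuous_intros) auto

lemma scaled_in_disk: "of_real t * z \<in> ball 0 1" if "z \<in> ball 0 1" "t \<in> {0..1}" for z :: complex
  using mult_left_le_one_le[of "norm z" t] that by (simp add: norm_mult)

lemma H_0: "H 0 = 1"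
  using Euler_eq[of 0] gamma_nz by (simp add: h_0)

lemma D_time_0: "D z 0 = 1" and D_at_0: "D 0 t = 1"
  by (simp_all add: D_def H_0 h_0)

lemma norm_one_minus_s_le:
  assumes "0 < t" "t \<le> 1"
  shows "norm (1 - s t) \<le> norm \<gamma> / Re \<gamma> * (1 - t powr (2 * Re \<gamma>))"
  using norm_one_minus_exp_le[of "2 * \<gamma>" "- ln t"] assms Re_gamma
  by (simp add: s_def powr_def Ln_of_real mult_ac norm_mult)

text \<open>
  This is where the hypothesis enters. On the circle \<open>\<bar>\<zeta>\<bar> = t\<close> the factor \<open>1 - t powr (2 Re \<gamma>)\<close>
  that bounds \<open>1 - s t\<close> is exactly the one in the damping condition; \<open>\<zeta> = t z\<close> lies strictly
  inside that circle, which makes the inequality strict.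
\<close>

lemma norm_X_less:
  assumes z: "z \<in> ball 0 1" and t: "t \<in> {0..1}"
  shows "norm (X z t) < norm (\<gamma> * h (of_real t * z))"
proof -
  let ?\<zeta> = "of_real t * z"
  have pos: "norm (\<gamma> * h ?\<zeta>) > 0"
    using h_nz[OF scaled_in_disk[OF z t]] gamma_nz by simp
  show ?thesis
  proof (cases "t = 0 \<or> t = 1 \<or> ?\<zeta> * deriv h ?\<zeta> = 0")
    case True
    then have "X z t = 0" unfolding X_def by auto
    then show ?thesis using pos by simp
  next
    case False
    then have t': "0 < t" "t < 1" and q: "norm (?\<zeta> * deriv h ?\<zeta>) > 0"
      using t by auto
    have "norm ?\<zeta> < t"
      using z t' by (simp add: norm_mult)
    then have "norm ?\<zeta> powr (2 * Re \<gamma>) < t powr (2 * Re \<gamma>)"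
      using Re_gamma by (intro powr_less_mono2) auto
    then have lt: "1 - t powr (2 * Re \<gamma>) < 1 - norm ?\<zeta> powr (2 * Re \<gamma>)"
      by simp
    have "norm (X z t) = norm (1 - s t) * norm (?\<zeta> * deriv h ?\<zeta>)"
      unfolding X_def by (simp add: norm_mult)
    also have "\<dots> \<le> norm \<gamma> / Re \<gamma> * (1 - t powr (2 * Re \<gamma>)) * norm (?\<zeta> * deriv h ?\<zeta>)"
      using norm_one_minus_s_le[of t] t' by (intro mult_right_mono) auto
    also have "\<dots> < norm \<gamma> / Re \<gamma> * (1 - norm ?\<zeta> powr (2 * Re \<gamma>)) * norm (?\<zeta> * deriv h ?\<zeta>)"
      using lt q gamma_nz Re_gamma by (intro mult_strict_right_mono mult_strict_left_mono) auto
    also have "\<dots> = norm \<gamma> / Re \<gamma> * ((1 - norm ?\<zeta> powr (2 * Re \<gamma>)) * norm (?\<zeta> * deriv h ?\<zeta>))"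
      by (simp only: mult.assoc)
    also have "\<dots> \<le> norm \<gamma> / Re \<gamma> * (Re \<gamma> * norm (h ?\<zeta>))"
      using damping[OF scaled_in_disk[OF z t]] Re_gamma by (intro mult_left_mono) auto
    also have "\<dots> = norm (\<gamma> * h ?\<zeta>)"
      using Re_gamma by (simp add: norm_mult)
    finally show ?thesis .
  qed
qed

lemma radial_derivative_D:
  assumes "z \<in> ball 0 1" "t \<in> {0..1}"
  shows "\<gamma> * D z t + z * Dz z t = \<gamma> * h (of_real t * z) + X z t"
  using Euler_eq[OF scaled_in_disk[OF assms]] unfolding D_def Dz_def X_def by algebra

lemma radial_derivative_D_nz:
  assumes "z \<in> ball 0 1" "t \<in> {0..1}"
  shows "\<gamma> * h (of_real t * z) + X z t \<noteq> 0"
proof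
  assume "\<gamma> * h (of_real t * z) + X z t = 0"
  then have "\<gamma> * h (of_real t * z) = - X z t" by (simp add: eq_neg_iff_add_eq_0)
  then show False using norm_X_less[OF assms] by simp
qed

text \<open>
  The quotient \<open>b / a\<close> is \<open>z / t\<close> times a Cayley transform of \<open>X / (\<gamma> h)\<close>, and the latter has
  modulus less than 1. This is the positivity of the real part of the Herglotz function in the
  Loewner equation.
\<close>

lemma drift_points_inward:
  assumes z: "z \<in> ball 0 1" and t: "t \<in> {0..1}" and pos: "0 < t" and "z \<noteq> 0"
    and ab: "b / a = z / of_real t * ((X z t - \<gamma> * h (of_real t * z)) / (\<gamma> * h (of_real t * z) + X z t))"
  shows "Re (cnj z * (b / a)) < 0"
proof -
  let ?V = "(X z t - \<gamma> * h (of_real t * z)) / (\<gamma> * h (of_real t * z) + X z t)"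
  have "cnj z * (b / a) = of_real ((norm z)\<^sup>2 / t) * ?V"
    unfolding ab by (simp add: complex_norm_square[symmetric] mult_ac flip: of_real_power)
  then have "Re (cnj z * (b / a)) = (norm z)\<^sup>2 / t * Re ?V"
    by (simp only: Re_complex_of_real Im_complex_of_real times_complex.sel mult_zero_left diff_zero)
  also have "\<dots> < 0"
    using Re_Cayley_neg[OF norm_X_less[OF z t]] pos \<open>z \<noteq> 0\<close> by (intro mult_pos_neg) auto
  finally show ?thesis .
qed

lemma continuous_on_scaled:
  assumes "f holomorphic_on ball 0 1"
  shows "continuous_on (ball 0 1 \<times> {0..1}) (\<lambda>x. f (of_real (snd x) * fst x))"
  by (rule continuous_on_compose2[OF holomorphic_on_imp_continuous_on[OF assms]])
    (use scaled_in_disk in \<open>auto intro!: continuous_intros\<close>)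

lemma continuous_on_s_snd: "continuous_on (ball 0 1 \<times> {0..1}) (\<lambda>x. s (snd x))"
  by (rule continuous_on_compose2[OF continuous_on_s]) (auto intro!: continuous_intros)

lemma continuous_on_D: "continuous_on (ball 0 1 \<times> {0..1}) (\<lambda>x. D (fst x) (snd x))"
  unfolding D_def
  by (intro continuous_intros continuous_on_scaled continuous_on_s_snd h_holo H_holo)

lemma continuous_on_Dz: "continuous_on (ball 0 1 \<times> {0..1}) (\<lambda>x. Dz (fst x) (snd x))"
  unfolding Dz_def
  by (intro continuous_intros continuous_on_scaled continuous_on_s_snd holomorphic_deriv
      h_holo H_holo open_ball)

lemma has_field_derivative_D:
  assumes "z \<in> ball 0 1" "t \<in> {0..1}"
  shows "((\<lambda>z. D z t) has_field_derivative Dz z t) (at z)"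
proof -
  have "(h has_field_derivative deriv h (of_real t * z)) (at (of_real t * z))"
    "(H has_field_derivative deriv H (of_real t * z)) (at (of_real t * z))"
    using holomorphic_derivI[OF _ open_ball scaled_in_disk[OF assms]] h_holo H_holo by auto
  then show ?thesis
    unfolding D_def Dz_def
    by (auto intro!: derivative_eq_intros DERIV_chain2[of h] DERIV_chain2[of H] simp: algebra_simps)
qed

text \<open>
  The derivative of \<open>s\<close> contributes \<open>2\<gamma> s (H - h) / t\<close> to the time derivative; the Euler equation
  turns this into derivatives of \<open>H\<close> and \<open>h\<close>, which gives the closed form of \<open>Dt\<close>.
\<close>

lemma has_derivative_D:
  assumes z: "z \<in> ball 0 1" and t: "t \<in> {0..1}" "0 < t"
  shows "((\<lambda>x. D (fst x) (snd x)) has_derivative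
           (\<lambda>v. Dz z t * fst v + of_real (snd v) * Dt z t)) (at (z, t))"
proof -
  let ?\<zeta> = "of_real t * z"
  have scaled: "((\<lambda>x. f (of_real (snd x) * fst x)) has_derivative
      (\<lambda>v. deriv f ?\<zeta> * (of_real (snd v) * z + of_real t * fst v))) (at (z, t))"
    if "f holomorphic_on ball 0 1" for f :: "complex \<Rightarrow> complex"
  proof -
    have "(f has_derivative (*) (deriv f ?\<zeta>)) (at ?\<zeta>)"
      using holomorphic_derivI[OF that open_ball scaled_in_disk[OF z t(1)], of UNIV]
      by (simp add: has_field_derivative_def)
    moreover have "((\<lambda>x. of_real (snd x) * fst x) has_derivative
        (\<lambda>v. of_real (snd v) * z + of_real t * fst v)) (at (z, t))"
      by (auto intro!: derivative_eq_intros simp: algebra_simps)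
    ultimately show ?thesis
      using has_derivative_compose[of "\<lambda>x. of_real (snd x) * fst x" _ "(z, t)" UNIV f] by fastforce
  qed
  have "(s has_vector_derivative 2 * \<gamma> * of_real t powr (2 * \<gamma> - 1)) (at t)"
    unfolding s_def using t
    by (intro has_vector_derivative_real_field[where f = "\<lambda>x. x powr (2 * \<gamma>)"])
      (auto intro!: has_field_derivative_powr simp: complex_nonpos_Reals_iff)
  moreover have "of_real t powr (2 * \<gamma> - 1) = s t / of_real t"
    using t by (simp add: s_def powr_diff)
  ultimately have "(s has_derivative (\<lambda>x. of_real x * (2 * \<gamma> * s t / of_real t))) (at t)"
    by (simp add: has_vector_derivative_def scaleR_conv_of_real)
  then have s': "((\<lambda>x. s (snd x)) has_derivative
      (\<lambda>v. of_real (snd v) * (2 * \<gamma> * s t / of_real t))) (at (z, t))"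
    using has_derivative_compose[of snd snd "(z, t)" UNIV s] by (auto simp: has_derivative_snd[OF has_derivative_ident])
  have "((\<lambda>x. D (fst x) (snd x)) has_derivative
      (\<lambda>v. s t * (deriv H ?\<zeta> * (of_real (snd v) * z + of_real t * fst v))
        + of_real (snd v) * (2 * \<gamma> * s t / of_real t) * H ?\<zeta>
        + ((1 - s t) * (deriv h ?\<zeta> * (of_real (snd v) * z + of_real t * fst v))
        + (0 - of_real (snd v) * (2 * \<gamma> * s t / of_real t)) * h ?\<zeta>))) (at (z, t))"
    unfolding D_def
    using has_derivative_add[OF has_derivative_mult[OF s' scaled[OF H_holo]]
        has_derivative_mult[OF has_derivative_diff[OF has_derivative_const[of 1] s'] scaled[OF h_holo]]]
    by simp
  moreover have "s t * (deriv H ?\<zeta> * (of_real (snd v) * z + of_real t * fst v))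
        + of_real (snd v) * (2 * \<gamma> * s t / of_real t) * H ?\<zeta>
        + ((1 - s t) * (deriv h ?\<zeta> * (of_real (snd v) * z + of_real t * fst v))
        + (0 - of_real (snd v) * (2 * \<gamma> * s t / of_real t)) * h ?\<zeta>)
      = Dz z t * fst v + of_real (snd v) * Dt z t" (is "?L = ?R") for v
  proof -
    \<comment> \<open>Multiplied by \<open>t\<close>, the identity is a polynomial consequence of the Euler equation.\<close>
    have "of_real t * ?L = of_real t * ?R"
      using Euler_eq[OF scaled_in_disk[OF z t(1)]] t
      unfolding Dz_def Dt_def X_def
      by (simp add: field_simps) algebra
    then show ?thesis using t by simp
  qed
  ultimately show ?thesis by simp
qed


section \<open>Absence of zeros and the logarithm of the chain\<close>

lemma Dz_nz_at_zero:
  assumes "z \<in> ball 0 1" "t \<in> {0..1}" "D z t = 0"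
  shows "Dz z t \<noteq> 0"
  using radial_derivative_D[OF assms(1,2)] radial_derivative_D_nz[OF assms(1,2)] assms(3) by auto

text \<open>
  A zero would entail, by compactness of \<open>cball 0 (norm z) \<times> {0..1}\<close>, one at a smallest time. That time is positive as
  \<open>D = 1\<close> at time 0, and a backward step produces a zero at a still smaller time.
\<close>

lemma D_nz:
  assumes z: "z \<in> ball 0 1" and t: "t \<in> {0..1}"
  shows "D z t \<noteq> 0"
proof
  assume Dzero: "D z t = 0"
  define r where "r = norm z"
  have r: "r < 1" using z by (simp add: r_def)
  define K where "K = cball (0::complex) r \<times> {0..1::real}"
  define Z where "Z = {x \<in> K. D (fst x) (snd x) = 0}"
  have K: "compact K" unfolding K_def by (intro compact_Times) auto
  have sub: "K \<subseteq> ball 0 1 \<times> {0..1}" using r by (auto simp: K_def)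
  have "closed Z"
    unfolding Z_def
    by (intro continuous_closed_preimage_constant continuous_on_subset[OF continuous_on_D sub]
        compact_imp_closed[OF K])
  then have "compact Z"
    using compact_Int_closed[OF K, of Z] by (simp add: Z_def Int_absorb1 Collect_conj_eq)
  moreover have "Z \<noteq> {}" using Dzero t by (auto simp: Z_def K_def r_def)
  ultimately have "\<exists>x\<in>Z. \<forall>y\<in>Z. snd x \<le> snd y"
    by (rule continuous_attains_inf) (intro continuous_intros)
  then obtain x where x: "x \<in> Z" and x_min: "\<And>y. y \<in> Z \<Longrightarrow> snd x \<le> snd y"
    by blast
  obtain w u where wu: "x = (w, u)" by (cases x)
  have w: "w \<in> ball 0 1" "norm w \<le> r" and u: "u \<in> {0..1}" and D0: "D w u = 0"
    using x r by (auto simp: Z_def K_def wu)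
  have u0: "0 < u" using D0 D_time_0[of w] u by (cases "u = 0") auto
  have w0: "w \<noteq> 0" using D0 D_at_0[of u] by auto
  have Dz0: "Dz w u \<noteq> 0" by (rule Dz_nz_at_zero[OF w(1) u D0])
  have rad: "w * Dz w u = \<gamma> * h (of_real u * w) + X w u"
    using radial_derivative_D[OF w(1) u] D0 by simp
  have drift: "Dt w u / Dz w u = w / of_real u *
      ((X w u - \<gamma> * h (of_real u * w)) / (\<gamma> * h (of_real u * w) + X w u))"
  proof -
    have "Dt w u = (X w u - \<gamma> * h (of_real u * w)) / of_real u"
      unfolding Dt_def rad by simp
    then show ?thesis
      unfolding rad[symmetric] using w0 by simp
  qed
  have "continuous_on (ball 0 1 \<times> {0<..1}) (\<lambda>x. D (fst x) (snd x))"
    by (rule continuous_on_subset[OF continuous_on_D]) auto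
  note step = backward_step_in_disk[OF this
      has_derivative_at_withinI[OF has_derivative_D[OF w(1) u u0]] Dz0
      drift_points_inward[OF w(1) u u0 w0 drift] w(2) r u0 _ zero_less_one]
  have "\<exists>e0>0. \<forall>e. 0 < e \<and> e < e0 \<longrightarrow>
      (\<exists>z'. norm z' \<le> r \<and> dist z' w < 1 \<and> D z' (u - e) = D w u)"
    using step u by simp
  then obtain e0 where e0: "e0 > 0" and earlier: "\<And>e. 0 < e \<Longrightarrow> e < e0 \<Longrightarrow>
      \<exists>z'. norm z' \<le> r \<and> dist z' w < 1 \<and> D z' (u - e) = D w u"
    by blast
  define e where "e = min e0 u / 2"
  have e: "0 < e" "e < e0" "e < u" using e0 u0 by (auto simp: e_def)
  obtain z' where "norm z' \<le> r" "D z' (u - e) = 0"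
    using earlier[OF e(1,2)] D0 by auto
  then have "(z', u - e) \<in> Z"
    using e u by (auto simp: Z_def K_def)
  then show False using x_min[of "(z', u - e)"] e by (simp add: wu)
qed

lemma log_D_exists:
  obtains \<Lambda> where "continuous_on (ball 0 1 \<times> {0..1}) \<Lambda>"
    "\<And>z t. z \<in> ball 0 1 \<Longrightarrow> t \<in> {0..1} \<Longrightarrow> exp (\<Lambda> (z, t)) = D z t" "\<Lambda> (0, 1) = 0"
proof -
  have "contractible (ball (0::complex) 1 \<times> {0..1::real})"
    by (intro convex_imp_contractible convex_Times) auto
  then obtain g where g: "continuous_on (ball 0 1 \<times> {0..1}) g"
    "\<And>x. x \<in> ball 0 1 \<times> {0..1} \<Longrightarrow> D (fst x) (snd x) = exp (g x)"
    by (rule continuous_logarithm_on_contractible[OF continuous_on_D]) (use D_nz in auto)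
  show ?thesis
  proof
    show "continuous_on (ball 0 1 \<times> {0..1}) (\<lambda>x. g x - g (0, 1))"
      by (intro continuous_intros g(1))
    show "exp (g (z, t) - g (0, 1)) = D z t" if "z \<in> ball 0 1" "t \<in> {0..1}" for z t
      using g(2)[of "(z, t)"] g(2)[of "(0, 1)"] that D_at_0[of 1] by (simp add: exp_diff)
  qed simp
qed

section \<open>Univalence of the chain\<close>

context
  fixes \<Lambda> :: "complex \<times> real \<Rightarrow> complex"
  assumes cont_\<Lambda>: "continuous_on (ball 0 1 \<times> {0..1}) \<Lambda>"
    and exp_\<Lambda>: "z \<in> ball 0 1 \<Longrightarrow> t \<in> {0..1} \<Longrightarrow> exp (\<Lambda> (z, t)) = D z t"
begin

text \<open>
  The Loewner chain without its normalising factor \<open>1 / t\<close>, which has no influence on injectivity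
  at a fixed time and would be singular at \<open>t = 0\<close>.
\<close>

definition chain :: "complex \<Rightarrow> real \<Rightarrow> complex" where
  "chain z t = z * exp (\<Lambda> (z, t) / \<gamma>)"

definition chain_z :: "complex \<Rightarrow> real \<Rightarrow> complex" where
  "chain_z z t = exp (\<Lambda> (z, t) / \<gamma>) * (1 + z * (Dz z t / D z t) / \<gamma>)"

lemma log_has_field_derivative:
  assumes z: "z \<in> ball 0 1" and t: "t \<in> {0..1}"
  shows "((\<lambda>z. \<Lambda> (z, t)) has_field_derivative Dz z t / D z t) (at z)"
proof -
  have cont: "continuous_on (ball 0 1) (\<lambda>z. \<Lambda> (z, t))"
    by (rule continuous_on_compose2[OF cont_\<Lambda>]) (use t in \<open>auto intro!: continuous_intros\<close>)
  have der: "((\<lambda>z. D z t) has_derivative (*) (Dz z t)) (at z within ball 0 1)"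
    using has_field_derivative_D[OF z t] unfolding has_field_derivative_def
    by (rule has_derivative_at_withinI)
  have "((\<lambda>z. \<Lambda> (z, t)) has_derivative (\<lambda>v. Dz z t * v / D z t)) (at z within ball 0 1)"
    by (rule has_derivative_continuous_log[OF cont _ z der]) (rule exp_\<Lambda>[OF _ t])
  then have "((\<lambda>z. \<Lambda> (z, t)) has_derivative (\<lambda>v. Dz z t * v / D z t)) (at z)"
    by (simp only: at_within_open[OF z open_ball])
  moreover have "(\<lambda>v. Dz z t * v / D z t) = (*) (Dz z t / D z t)"
    by (simp add: fun_eq_iff)
  ultimately show ?thesis
    unfolding has_field_derivative_def by (simp only:)
qed

lemma chain_has_field_derivative:
  assumes "z \<in> ball 0 1" "t \<in> {0..1}"
  shows "((\<lambda>z. chain z t) has_field_derivative chain_z z t) (at z)"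
proof -
  have "((\<lambda>z. exp (\<Lambda> (z, t) / \<gamma>)) has_field_derivative
      exp (\<Lambda> (z, t) / \<gamma>) * (Dz z t / D z t / \<gamma>)) (at z)"
    by (rule DERIV_chain2[OF DERIV_exp DERIV_cdivide[OF log_has_field_derivative[OF assms]]])
  from DERIV_mult[OF DERIV_ident this]
  have "((\<lambda>z. chain z t) has_field_derivative
      1 * exp (\<Lambda> (z, t) / \<gamma>) + exp (\<Lambda> (z, t) / \<gamma>) * (Dz z t / D z t / \<gamma>) * z) (at z)"
    unfolding chain_def .
  moreover have "1 * exp (\<Lambda> (z, t) / \<gamma>) + exp (\<Lambda> (z, t) / \<gamma>) * (Dz z t / D z t / \<gamma>) * z = chain_z z t"
    unfolding chain_z_def by (simp add: distrib_left mult_ac)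
  ultimately show ?thesis by (simp only:)
qed

lemma chain_z_eq:
  assumes "z \<in> ball 0 1" "t \<in> {0..1}"
  shows "chain_z z t = exp (\<Lambda> (z, t) / \<gamma>) * ((\<gamma> * h (of_real t * z) + X z t) / (\<gamma> * D z t))"
  unfolding chain_z_def radial_derivative_D[OF assms, symmetric]
  using D_nz[OF assms] gamma_nz by (simp add: add_divide_distrib)

lemma chain_z_nz:
  assumes "z \<in> ball 0 1" "t \<in> {0..1}"
  shows "chain_z z t \<noteq> 0"
  unfolding chain_z_eq[OF assms]
  using D_nz[OF assms] gamma_nz radial_derivative_D_nz[OF assms] by simp

lemma continuous_on_chain: "continuous_on (ball 0 1 \<times> {0..1}) (\<lambda>x. chain (fst x) (snd x))"
  unfolding chain_def using gamma_nz by (auto intro!: continuous_intros cont_\<Lambda>)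

lemma continuous_on_chain_z: "continuous_on (ball 0 1 \<times> {0..1}) (\<lambda>x. chain_z (fst x) (snd x))"
  unfolding chain_z_def using gamma_nz D_nz
  by (auto intro!: continuous_intros cont_\<Lambda> continuous_on_D continuous_on_Dz)

lemma inj_on_chain_0: "inj_on (\<lambda>z. chain z 0) (ball 0 1)"
proof -
  have "((\<lambda>z. \<Lambda> (z, 0)) has_field_derivative 0) (at z within ball 0 1)" if "z \<in> ball 0 1" for z
    using has_field_derivative_at_within[OF log_has_field_derivative[OF that, of 0]]
    by (simp add: Dz_def)
  then obtain c where c: "\<And>z. z \<in> ball 0 1 \<Longrightarrow> \<Lambda> (z, 0) = c"
    using has_field_derivative_zero_constant[OF convex_ball, of 0 1 "\<lambda>z. \<Lambda> (z, 0)"] by blast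
  show ?thesis
    by (rule inj_onI) (simp add: chain_def c)
qed

text \<open>
  The radius is uniform in the time \<open>u\<close>, so that two colliding points cannot merge in the limit; this
  makes the set of collisions closed. The reason is that \<open>chain_z\<close> is jointly continuous and stays
  close to the nonzero number \<open>chain_z z t\<close>.
\<close>

lemma chain_locally_injective:
  assumes z: "z \<in> ball 0 1" and t: "t \<in> {0..1}"
  obtains d where "d > 0" "\<And>a b u. a \<in> ball 0 1 \<Longrightarrow> b \<in> ball 0 1 \<Longrightarrow> u \<in> {0..1} \<Longrightarrow>
    norm (a - z) < d \<Longrightarrow> norm (b - z) < d \<Longrightarrow> norm (u - t) < d \<Longrightarrow>
    chain a u = chain b u \<Longrightarrow> a = b"
proof -
  define c where "c = chain_z z t"
  have c: "norm c > 0" using chain_z_nz[OF z t] by (simp add: c_def)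
  obtain e where e: "e > 0" and close: "\<And>y. y \<in> ball 0 1 \<times> {0..1} \<Longrightarrow> dist y (z, t) < e \<Longrightarrow>
      dist (chain_z (fst y) (snd y)) c < norm c / 2"
    using continuous_on_chain_z z t c unfolding continuous_on_iff c_def
    by (metis SigmaI fst_conv half_gt_zero snd_conv)
  have "a = b" if ab: "a \<in> ball 0 1" "b \<in> ball 0 1" and u: "u \<in> {0..1}"
    and near: "norm (a - z) < e / 2" "norm (b - z) < e / 2" "norm (u - t) < e / 2"
    and eq: "chain a u = chain b u" for a b u
  proof -
    let ?C = "ball 0 1 \<inter> ball z (e / 2)"
    have "norm ((chain a u - c * a) - (chain b u - c * b)) \<le> norm c / 2 * norm (a - b)"
    proof (rule field_differentiable_bound)
      show "convex ?C" by (intro convex_Int convex_ball)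
      show "a \<in> ?C" "b \<in> ?C" using ab near by (auto simp: dist_norm norm_minus_commute)
      fix x assume x: "x \<in> ?C"
      have "((\<lambda>x. chain x u - c * x) has_field_derivative chain_z x u - c) (at x)"
        using chain_has_field_derivative[of x u] x u by (auto intro!: derivative_eq_intros)
      then show "((\<lambda>x. chain x u - c * x) has_field_derivative chain_z x u - c) (at x within ?C)"
        by (rule has_field_derivative_at_within)
      have "dist (x, u) (z, t) < e"
        using norm_Pair_le[of "x - z" "u - t"] x near
        by (simp add: dist_norm norm_minus_commute)
      then show "norm (chain_z x u - c) \<le> norm c / 2"
        using close[of "(x, u)"] x u by (simp add: dist_norm)
    qed
    moreover have "norm ((chain a u - c * a) - (chain b u - c * b)) = norm c * norm (a - b)"
      unfolding eq by (simp add: norm_mult[symmetric] algebra_simps norm_minus_commute)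
    ultimately have "norm c * norm (a - b) \<le> 0" by simp
    then show "a = b" using c by (simp add: mult_le_0_iff)
  qed
  then show ?thesis using that[of "e / 2"] e by simp
qed

text \<open>
  It is \<open>chain / t\<close>, not \<open>chain\<close>, that satisfies the Loewner equation and whose level sets therefore
  move inward backwards in time.
\<close>

lemma chain_backward_step:
  assumes z: "norm z \<le> r" "r < 1" and t: "0 < t" "t \<le> 1" and z0: "z \<noteq> 0" and \<delta>: "\<delta> > 0"
  shows "\<exists>e0>0. \<forall>e. 0 < e \<and> e < e0 \<longrightarrow> (\<exists>z'. norm z' \<le> r \<and> dist z' z < \<delta> \<and>
           chain z' (t - e) / of_real (t - e) = chain z t / of_real t)"
proof -
  let ?S = "ball (0::complex) 1 \<times> {0..1::real}"
  let ?\<Psi> = "\<lambda>x. chain (fst x) (snd x) / of_real (snd x)"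
  have zb: "z \<in> ball 0 1" and tb: "t \<in> {0..1}" using z t by auto
  note Dnz = D_nz[OF zb tb] and Nnz = radial_derivative_D_nz[OF zb tb]
  define E where "E = exp (\<Lambda> (z, t) / \<gamma>)"
  define a where "a = chain_z z t / of_real t"
  define b where "b = z * E * ((Dt z t / D z t) / \<gamma>) / of_real t - z * E / (of_real t)\<^sup>2"
  have E: "E \<noteq> 0" by (simp add: E_def)
  have cont: "continuous_on (ball 0 1 \<times> {0<..1}) ?\<Psi>"
    by (intro continuous_intros continuous_on_subset[OF continuous_on_chain]) auto
  define L' where "L' v = (Dz z t * fst v + of_real (snd v) * Dt z t) / D z t" for v :: "complex \<times> real"
  have expS: "exp (\<Lambda> x) = D (fst x) (snd x)" if "x \<in> ?S" for x
    using exp_\<Lambda>[of "fst x" "snd x"] that by auto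
  have ztS: "(z, t) \<in> ?S" using zb tb by simp
  have "((\<lambda>x. D (fst x) (snd x)) has_derivative
      (\<lambda>v. Dz z t * fst v + of_real (snd v) * Dt z t)) (at (z, t) within ?S)"
    by (rule has_derivative_at_withinI[OF has_derivative_D[OF zb tb t(1)]])
  from has_derivative_continuous_log[OF cont_\<Lambda> expS ztS this]
  have "(\<Lambda> has_derivative L') (at (z, t) within ?S)"
    by (simp add: L'_def[abs_def])
  then have "((\<lambda>x. \<Lambda> x / \<gamma>) has_derivative (\<lambda>v. L' v / \<gamma>)) (at (z, t) within ?S)"
    by (auto intro!: derivative_eq_intros simp: gamma_nz)
  then have "((\<lambda>x. exp (\<Lambda> x / \<gamma>)) has_derivative (\<lambda>v. E * (L' v / \<gamma>))) (at (z, t) within ?S)"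
    using has_derivative_compose[OF _ DERIV_exp[unfolded has_field_derivative_def]]
    unfolding E_def by blast
  then have "((\<lambda>x. fst x * exp (\<Lambda> x / \<gamma>)) has_derivative (\<lambda>v. z * (E * (L' v / \<gamma>)) + fst v * E))
      (at (z, t) within ?S)"
    using has_derivative_mult[OF has_derivative_fst[OF has_derivative_ident]] by (fastforce simp: E_def)
  moreover have "((\<lambda>x. inverse (complex_of_real (snd x))) has_derivative (\<lambda>v. - of_real (snd v) / (of_real t)\<^sup>2))
      (at (z, t) within ?S)"
    using t by (auto intro!: derivative_eq_intros simp: power2_eq_square field_simps)
  ultimately have "((\<lambda>x. fst x * exp (\<Lambda> x / \<gamma>) * inverse (of_real (snd x))) has_derivative
      (\<lambda>v. z * E * (- of_real (snd v) / (of_real t)\<^sup>2)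
        + (z * (E * (L' v / \<gamma>)) + fst v * E) * inverse (of_real t))) (at (z, t) within ?S)"
    using has_derivative_mult by (fastforce simp: E_def)
  moreover have "z * E * (- of_real (snd v) / (of_real t)\<^sup>2)
        + (z * (E * (L' v / \<gamma>)) + fst v * E) * inverse (of_real t)
      = a * fst v + of_real (snd v) * b" for v
    unfolding a_def b_def L'_def chain_z_def E_def[symmetric]
    by (simp add: divide_inverse algebra_simps)
  ultimately have "(?\<Psi> has_derivative (\<lambda>v. a * fst v + of_real (snd v) * b)) (at (z, t) within ?S)"
    unfolding chain_def by (simp add: divide_inverse)
  moreover have a0: "a \<noteq> 0"
    using chain_z_nz[OF zb tb] t by (simp add: a_def)
  moreover have "b / a = z / of_real t *
      ((X z t - \<gamma> * h (of_real t * z)) / (\<gamma> * h (of_real t * z) + X z t))"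
  proof -
    have "b = z * E / ((of_real t)\<^sup>2 * (\<gamma> * D z t)) * (of_real t * Dt z t - \<gamma> * D z t)"
      unfolding b_def using t gamma_nz Dnz by (simp add: field_simps power2_eq_square)
    also have "of_real t * Dt z t - \<gamma> * D z t = 2 * X z t - (\<gamma> * D z t + z * Dz z t)"
      using t by (simp add: Dt_def)
    also have "\<dots> = X z t - \<gamma> * h (of_real t * z)"
      unfolding radial_derivative_D[OF zb tb] by simp
    finally have "b = z * E / ((of_real t)\<^sup>2 * (\<gamma> * D z t)) * (X z t - \<gamma> * h (of_real t * z))" .
    moreover have "a = E / (of_real t * (\<gamma> * D z t)) * (\<gamma> * h (of_real t * z) + X z t)"
      unfolding a_def chain_z_eq[OF zb tb] E_def by simp
    ultimately show ?thesis
      using t gamma_nz Dnz E Nnz by (simp add: power2_eq_square)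
  qed
  ultimately show ?thesis
    using backward_step_in_disk[OF cont _ a0 drift_points_inward[OF zb tb t(1) z0] z t \<delta>, of b] by simp
qed

lemma chain_eq_0_iff [simp]: "chain z t = 0 \<longleftrightarrow> z = 0"
  by (simp add: chain_def)

text \<open>
  A collision \<open>chain z t = chain w t\<close> with \<open>z \<noteq> w\<close> in \<open>cball 0 r\<close> would occur at a smallest
  time. At time 0 the chain is linear, so that time is positive; backward steps
  from both points with the same step size keep them apart and give an earlier collision.
\<close>

lemma inj_on_chain:
  assumes r: "r < 1" and t: "t \<in> {0..1}"
  shows "inj_on (\<lambda>z. chain z t) (cball 0 r)"
proof (rule inj_onI, rule ccontr)
  fix z w assume zw: "z \<in> cball 0 r" "w \<in> cball 0 r" "chain z t = chain w t" "z \<noteq> w"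
  define K where "K = cball (0::complex) r \<times> cball (0::complex) r \<times> {0..1::real}"
  define Z where "Z = {(z, w, u) \<in> K. chain z u = chain w u \<and> z \<noteq> w}"
  have K: "compact K" unfolding K_def by (intro compact_Times) auto
  have sub: "cball (0::complex) r \<subseteq> ball 0 1" using r by auto
  have "closed Z"
    unfolding closed_sequential_limits
  proof (intro allI impI, elim conjE)
    fix x :: "nat \<Rightarrow> complex \<times> complex \<times> real" and l
    assume xZ: "\<forall>n. x n \<in> Z" and lim: "x \<longlonglongrightarrow> l"
    have "x n \<in> K" for n using xZ[rule_format, of n] by (auto simp: Z_def)
    then have "l \<in> K"
      using closed_sequentially[OF compact_imp_closed[OF K] _ lim] by blast
    moreover obtain a b u where l: "l = (a, b, u)" by (cases l) auto
    ultimately have ab: "a \<in> ball 0 1" "b \<in> ball 0 1" and u: "u \<in> {0..1}"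
      using sub by (auto simp: K_def)
    define p q v where "p n = fst (x n)" and "q n = fst (snd (x n))" and "v n = snd (snd (x n))" for n
    have xn: "p n \<in> ball 0 1" "q n \<in> ball 0 1" "v n \<in> {0..1}" "chain (p n) (v n) = chain (q n) (v n)"
      "p n \<noteq> q n" for n
      using xZ[rule_format, of n] sub by (auto simp: Z_def K_def p_def q_def v_def)
    have p: "p \<longlonglongrightarrow> a" and q: "q \<longlonglongrightarrow> b" and v: "v \<longlonglongrightarrow> u"
      using tendsto_fst[OF lim] tendsto_fst[OF tendsto_snd[OF lim]] tendsto_snd[OF tendsto_snd[OF lim]]
      by (simp_all add: l p_def[abs_def] q_def[abs_def] v_def[abs_def])
    have conv: "(\<lambda>n. chain (y n) (v n)) \<longlonglongrightarrow> chain c u"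
      if "y \<longlonglongrightarrow> c" "\<And>n. y n \<in> ball 0 1" "c \<in> ball 0 1" for y c
      using continuous_on_tendsto_compose[OF continuous_on_chain tendsto_Pair[OF that(1) v]]
        that u xn(3) by simp
    have "chain a u = chain b u"
      using LIMSEQ_unique[OF conv[OF p xn(1) ab(1)]] conv[OF q xn(2) ab(2)] xn(4) by simp
    moreover have "a \<noteq> b"
    proof
      assume "a = b"
      obtain d where d: "d > 0" "\<And>x y s. x \<in> ball 0 1 \<Longrightarrow> y \<in> ball 0 1 \<Longrightarrow> s \<in> {0..1} \<Longrightarrow>
          norm (x - a) < d \<Longrightarrow> norm (y - a) < d \<Longrightarrow> norm (s - u) < d \<Longrightarrow>
          chain x s = chain y s \<Longrightarrow> x = y"
        using chain_locally_injective[OF ab(1) u] by blast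
      have "\<forall>\<^sub>F n in sequentially. dist (p n) a < d \<and> dist (q n) a < d \<and> dist (v n) u < d"
        using p q v d(1) \<open>a = b\<close> by (auto intro!: eventually_conj tendstoD)
      then obtain n where "dist (p n) a < d" "dist (q n) a < d" "dist (v n) u < d"
        by (auto dest: eventually_happens)
      then show False
        using d(2)[OF xn(1,2,3), of n n n] xn(4,5)[of n] by (simp add: dist_norm)
    qed
    ultimately show "l \<in> Z" using \<open>l \<in> K\<close> by (simp add: Z_def l)
  qed
  moreover have "Z \<subseteq> K" by (auto simp: Z_def)
  ultimately have "compact Z"
    using compact_Int_closed[OF K, of Z] by (simp add: Int_absorb1)
  moreover have "(z, w, t) \<in> Z" using zw t by (auto simp: Z_def K_def)
  ultimately have "\<exists>x\<in>Z. \<forall>y\<in>Z. snd (snd x) \<le> snd (snd y)"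
    by (intro continuous_attains_inf continuous_intros) auto
  then obtain x where x: "x \<in> Z" and x_min: "\<And>y. y \<in> Z \<Longrightarrow> snd (snd x) \<le> snd (snd y)"
    by blast
  obtain a b u where xab: "x = (a, b, u)" by (cases x) auto
  have ab: "norm a \<le> r" "norm b \<le> r" and u: "0 \<le> u" "u \<le> 1"
    and eq: "chain a u = chain b u" and ne: "a \<noteq> b"
    using x by (auto simp: Z_def K_def xab)
  have "u \<noteq> 0"
    using inj_onD[OF inj_on_chain_0, of a b] eq ne ab r by auto
  then have u0: "0 < u" using u by simp
  have "a \<noteq> 0 \<and> b \<noteq> 0"
    using eq ne chain_eq_0_iff[of a u] chain_eq_0_iff[of b u] by metis
  then have a0: "a \<noteq> 0" and b0: "b \<noteq> 0" by auto
  define \<delta> where "\<delta> = dist a b / 2"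
  have \<delta>: "\<delta> > 0" using ne by (simp add: \<delta>_def)
  obtain e1 where e1: "e1 > 0" "\<And>e. 0 < e \<Longrightarrow> e < e1 \<Longrightarrow> \<exists>z'. norm z' \<le> r \<and> dist z' a < \<delta> \<and>
      chain z' (u - e) / of_real (u - e) = chain a u / of_real u"
    using chain_backward_step[OF ab(1) r u0 u(2) a0 \<delta>] by blast
  obtain e2 where e2: "e2 > 0" "\<And>e. 0 < e \<Longrightarrow> e < e2 \<Longrightarrow> \<exists>z'. norm z' \<le> r \<and> dist z' b < \<delta> \<and>
      chain z' (u - e) / of_real (u - e) = chain b u / of_real u"
    using chain_backward_step[OF ab(2) r u0 u(2) b0 \<delta>] by blast
  define e where "e = min u (min e1 e2) / 2"
  have e: "0 < e" "e < e1" "e < e2" "e < u" using e1(1) e2(1) u0 by (auto simp: e_def)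
  obtain a' b' where a': "norm a' \<le> r" "dist a' a < \<delta>"
      "chain a' (u - e) / of_real (u - e) = chain a u / of_real u"
    and b': "norm b' \<le> r" "dist b' b < \<delta>"
      "chain b' (u - e) / of_real (u - e) = chain b u / of_real u"
    using e1(2)[OF e(1,2)] e2(2)[OF e(1,3)] by blast
  have "chain a' (u - e) / of_real (u - e) = chain b' (u - e) / of_real (u - e)"
    by (simp only: a'(3) b'(3) eq)
  moreover have "complex_of_real (u - e) \<noteq> 0"
    using e unfolding of_real_eq_0_iff by linarith
  ultimately have "chain a' (u - e) = chain b' (u - e)"
    by (simp only: divide_cancel_right) blast
  moreover have "a' \<noteq> b'"
    using a'(2) b'(2) dist_triangle[of a b a'] by (auto simp: \<delta>_def dist_commute)
  ultimately have "(a', b', u - e) \<in> Z"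
    using a'(1) b'(1) e u by (auto simp: Z_def K_def)
  then show False using x_min[of "(a', b', u - e)"] e by (simp add: xab)
qed

end

text \<open>
  At time 1 the chain is \<open>z H(z) powr (1 / \<gamma>)\<close>, with the branch that is 1 at the origin.
\<close>

theorem univalent_root:
  obtains \<Lambda> where "\<Lambda> holomorphic_on ball 0 1" "\<Lambda> 0 = 0"
    "\<And>z. z \<in> ball 0 1 \<Longrightarrow> exp (\<Lambda> z) = H z"
    "inj_on (\<lambda>z. z * exp (\<Lambda> z / \<gamma>)) (ball 0 1)"
proof -
  obtain \<Lambda> where L: "continuous_on (ball 0 1 \<times> {0..1}) \<Lambda>"
    "\<And>z t. z \<in> ball 0 1 \<Longrightarrow> t \<in> {0..1} \<Longrightarrow> exp (\<Lambda> (z, t)) = D z t" "\<Lambda> (0, 1) = 0"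
    using log_D_exists by blast
  show ?thesis
  proof
    show "(\<lambda>z. \<Lambda> (z, 1)) holomorphic_on ball 0 1"
      unfolding holomorphic_on_open[OF open_ball]
    proof
      fix z :: complex assume "z \<in> ball 0 1"
      then have "((\<lambda>z. \<Lambda> (z, 1)) has_field_derivative Dz z 1 / D z 1) (at z)"
        by (intro log_has_field_derivative[OF L(1,2)]) auto
      then show "\<exists>f'. ((\<lambda>z. \<Lambda> (z, 1)) has_field_derivative f') (at z)" by blast
    qed
    show "exp (\<Lambda> (z, 1)) = H z" if "z \<in> ball 0 1" for z
      using L(2)[OF that, of 1] by (simp add: D_def)
    show "inj_on (\<lambda>z. z * exp (\<Lambda> (z, 1) / \<gamma>)) (ball 0 1)"
    proof (rule inj_onI)
      fix z w assume zw: "z \<in> ball (0::complex) 1" "w \<in> ball (0::complex) 1"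
        and eq: "z * exp (\<Lambda> (z, 1) / \<gamma>) = w * exp (\<Lambda> (w, 1) / \<gamma>)"
      have "inj_on (\<lambda>z. chain \<Lambda> z 1) (cball 0 (max (norm z) (norm w)))"
        using zw by (intro inj_on_chain[OF L(1)] L(2)) auto
      moreover have "chain \<Lambda> z 1 = chain \<Lambda> w 1"
        using eq chain_def[OF L(1)] L(2) by simp
      ultimately show "z = w" by (auto dest: inj_onD)
    qed
  qed (rule L(3))
qed

end

section \<open>Logarithms of the data\<close>

text \<open>
  At a zero of order \<open>n > 0\<close> the quotient \<open>P' / P\<close> has a simple pole, which contradicts the bound. It
  will be applied to \<open>P = f'\<close>; at a zero itself the quotient has the default value 0, so the
  contradiction has to come from the punctured neighbourhood.
\<close>

lemma zero_free_of_bounded_log_derivative: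
  fixes P a b :: "complex \<Rightarrow> complex" and c :: "complex \<Rightarrow> real"
  assumes P: "P holomorphic_on S" and S: "open S" "connected S" and nonconst: "\<not> P constant_on S"
    and cont: "continuous_on S a" "continuous_on S b" "continuous_on S c"
    and bound: "\<And>z. z \<in> S \<Longrightarrow> P z \<noteq> 0 \<Longrightarrow> c z * norm (a z * (deriv P z / P z) + b z) \<le> 1"
    and \<xi>: "\<xi> \<in> S" "a \<xi> \<noteq> 0" "c \<xi> > 0"
  shows "P \<xi> \<noteq> 0"
proof
  assume "P \<xi> = 0"
  from holomorphic_factor_zero_nonconstant[OF P S \<xi>(1) this nonconst]
  obtain q r n where n: "0 < n" and r: "0 < r" "ball \<xi> r \<subseteq> S" and q: "q holomorphic_on ball \<xi> r"
    and Pq: "\<And>w. w \<in> ball \<xi> r \<Longrightarrow> P w = (w - \<xi>) ^ n * q w"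
    and q_nz: "\<And>w. w \<in> ball \<xi> r \<Longrightarrow> q w \<noteq> 0" by metis
  \<comment> \<open>The bounded expression multiplied by \<open>w - \<xi>\<close>, which removes the pole.\<close>
  define \<Phi> where "\<Phi> w = c w * norm (a w * (of_nat n + (w - \<xi>) * (deriv q w / q w)) + (w - \<xi>) * b w)" for w
  have le: "\<Phi> w \<le> norm (w - \<xi>)" if w: "w \<in> ball \<xi> r" "w \<noteq> \<xi>" for w
  proof -
    have w\<xi>: "w - \<xi> \<noteq> 0" using w by simp
    have "((\<lambda>w. (w - \<xi>) ^ n * q w) has_field_derivative
        of_nat n * (w - \<xi>) ^ (n - 1) * q w + deriv q w * (w - \<xi>) ^ n) (at w)"
      using holomorphic_derivI[OF q open_ball w(1)] by (auto intro!: derivative_eq_intros)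
    then have "(P has_field_derivative of_nat n * (w - \<xi>) ^ (n - 1) * q w + deriv q w * (w - \<xi>) ^ n) (at w)"
      by (rule has_field_derivative_transform_within_open[OF _ open_ball w(1)]) (simp add: Pq)
    then have dP: "deriv P w = of_nat n * (w - \<xi>) ^ (n - 1) * q w + deriv q w * (w - \<xi>) ^ n"
      by (rule DERIV_imp_deriv)
    have pow: "(w - \<xi>) ^ n = (w - \<xi>) * (w - \<xi>) ^ (n - 1)"
      using n by (simp add: power_eq_if)
    have "(w - \<xi>) * (deriv P w / P w) = of_nat n + (w - \<xi>) * (deriv q w / q w)"
      unfolding dP Pq[OF w(1)] pow using q_nz[OF w(1)] w\<xi> by (simp add: field_simps)
    then have "\<Phi> w = c w * norm (a w * ((w - \<xi>) * (deriv P w / P w)) + (w - \<xi>) * b w)"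
      unfolding \<Phi>_def by simp
    also have "a w * ((w - \<xi>) * (deriv P w / P w)) + (w - \<xi>) * b w
        = (w - \<xi>) * (a w * (deriv P w / P w) + b w)"
      by (simp only: distrib_left mult_ac)
    finally have "\<Phi> w = c w * norm ((w - \<xi>) * (a w * (deriv P w / P w) + b w))" .
    also have "\<dots> = norm (w - \<xi>) * (c w * norm (a w * (deriv P w / P w) + b w))"
      by (simp add: norm_mult)
    also have "\<dots> \<le> norm (w - \<xi>) * 1"
      using bound[of w] w r(2) q_nz[OF w(1)] w\<xi> by (intro mult_left_mono) (auto simp: Pq)
    finally show ?thesis by simp
  qed
  have "continuous_on (ball \<xi> r) \<Phi>"
    unfolding \<Phi>_def using q_nz
    by (intro continuous_intros continuous_on_subset[OF cont(1) r(2)]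
        continuous_on_subset[OF cont(2) r(2)] continuous_on_subset[OF cont(3) r(2)]
        holomorphic_on_imp_continuous_on holomorphic_deriv q open_ball) auto
  then have "(\<Phi> \<longlongrightarrow> \<Phi> \<xi>) (at \<xi>)"
    using r(1) by (simp add: continuous_on_eq_continuous_at isCont_def)
  moreover have "((\<lambda>w. norm (w - \<xi>)) \<longlongrightarrow> 0) (at \<xi>)"
    by (auto intro!: tendsto_eq_intros)
  moreover have "\<forall>\<^sub>F w in at \<xi>. \<Phi> w \<le> norm (w - \<xi>)"
    using le r(1) by (auto simp: eventually_at dist_commute intro!: exI[of _ r])
  ultimately have "\<Phi> \<xi> \<le> 0"
    by (intro tendsto_le[of "at \<xi>" _ 0 \<Phi>]) auto
  moreover have "\<Phi> \<xi> > 0"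
    unfolding \<Phi>_def using \<xi> n by simp
  ultimately show False by simp
qed

text \<open>
  This links the global branches to principal powers, which need not agree away from the origin.
\<close>

lemma eventually_powr_exp:
  fixes l :: "complex \<Rightarrow> complex"
  assumes "l holomorphic_on ball 0 1" "l 0 = 0"
  shows "\<forall>\<^sub>F z in nhds 0. exp (l z) powr a = exp (a * l z)"
proof -
  have "isCont l 0"
    using assms(1) by (auto intro: continuous_on_interior dest!: holomorphic_on_imp_continuous_on)
  then have "(l \<longlongrightarrow> l 0) (nhds 0)"
    unfolding isCont_def tendsto_at_iff_tendsto_nhds .
  then have "\<forall>\<^sub>F z in nhds 0. norm (l z) < 1"
    using assms(2) by (auto dest!: tendstoD[of _ _ _ 1])
  then show ?thesis
  proof eventually_elim
    case (elim z)
    then have "Ln (exp (l z)) = l z"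
      using abs_Im_le_cmod[of "l z"] pi_gt3 by (intro Ln_exp) auto
    then show ?case by (simp add: powr_def)
  qed
qed

lemma normalised_log_exists:
  fixes P :: "complex \<Rightarrow> complex"
  assumes P: "P holomorphic_on ball 0 1" and nz: "\<And>z. z \<in> ball 0 1 \<Longrightarrow> P z \<noteq> 0" and P0: "P 0 = 1"
  obtains l where "l holomorphic_on ball 0 1" "l 0 = 0" "\<And>z. z \<in> ball 0 1 \<Longrightarrow> exp (l z) = P z"
proof -
  obtain l where l: "l holomorphic_on ball 0 1" "\<And>z. z \<in> ball 0 1 \<Longrightarrow> P z = exp (l z)"
    using contractible_imp_holomorphic_log[OF P convex_imp_contractible[OF convex_ball] nz] by blast
  show ?thesis
  proof
    show "(\<lambda>z. l z - l 0) holomorphic_on ball 0 1" by (intro holomorphic_intros l(1))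
    show "exp (l z - l 0) = P z" if "z \<in> ball 0 1" for z
      using l(2)[OF that] l(2)[of 0] P0 by (simp add: exp_diff)
  qed simp
qed

lemma deriv_eq_log_deriv:
  assumes l: "l holomorphic_on ball 0 1" and exp_l: "\<And>z. z \<in> ball 0 1 \<Longrightarrow> exp (l z) = P z"
    and z: "z \<in> ball 0 1"
  shows "deriv l z = deriv P z / P z"
proof -
  have "((\<lambda>z. exp (l z)) has_field_derivative exp (l z) * deriv l z) (at z)"
    by (rule DERIV_chain2[OF DERIV_exp holomorphic_derivI[OF l open_ball z]])
  then have "(P has_field_derivative exp (l z) * deriv l z) (at z)"
    by (rule has_field_derivative_transform_within_open[OF _ open_ball z]) (simp add: exp_l)
  then have "deriv P z = P z * deriv l z"
    using exp_l[OF z] by (simp add: DERIV_imp_deriv)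
  moreover have "P z \<noteq> 0" using exp_l[OF z] by (metis exp_not_eq_zero)
  ultimately show ?thesis by simp
qed

text \<open>
  Dividing out the simple zero of \<open>g\<close> and \<open>\<phi>\<close> at the origin leaves zero-free functions. Their
  quotient has a logarithm \<open>l\<close>, and \<open>g = \<phi> * exp l\<close> gives the relation of logarithmic derivatives.
\<close>

lemma log_class_quot_exists:
  assumes g: "g \<in> class_A" and \<phi>: "\<phi> \<in> class_A"
    and g_nz: "\<And>z. z \<in> unit_disk - {0} \<Longrightarrow> g z \<noteq> 0"
    and \<phi>_nz: "\<And>z. z \<in> unit_disk - {0} \<Longrightarrow> \<phi> z \<noteq> 0"
  obtains l where "l holomorphic_on unit_disk" "l 0 = 0"
    "\<And>z. z \<in> unit_disk \<Longrightarrow> exp (l z) = class_quot g \<phi> z"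
    "\<And>z. z \<in> unit_disk \<Longrightarrow> z_log_deriv g z - z_log_deriv \<phi> z = z * deriv l z"
proof -
  have A: "g holomorphic_on unit_disk" "g 0 = 0" "deriv g 0 = 1"
    "\<phi> holomorphic_on unit_disk" "\<phi> 0 = 0" "deriv \<phi> 0 = 1"
    using g \<phi> by (auto simp: class_A_def analytic_on_open)
  define g1 \<phi>1 where "g1 z = (if z = 0 then 1 else g z / z)" and "\<phi>1 z = (if z = 0 then 1 else \<phi> z / z)" for z
  have holo1: "(\<lambda>z. if z = 0 then 1 else f z / z) holomorphic_on unit_disk"
    if "f holomorphic_on unit_disk" "f 0 = 0" "deriv f 0 = 1" for f :: "complex \<Rightarrow> complex"
    using pole_lemma[OF that(1), of 0] that(2,3) by (simp add: interior_open cong: if_cong)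
  have quot: "class_quot g \<phi> z = g1 z / \<phi>1 z" if "z \<in> unit_disk" for z
    using that \<phi>_nz[of z] by (auto simp: class_quot_def g1_def \<phi>1_def)
  have \<phi>1_nz: "\<phi>1 z \<noteq> 0" and g1_nz: "g1 z \<noteq> 0" if "z \<in> unit_disk" for z
    using that \<phi>_nz[of z] g_nz[of z] by (auto simp: g1_def \<phi>1_def)
  have "(\<lambda>z. g1 z / \<phi>1 z) holomorphic_on unit_disk"
    using holo1[OF A(1-3)] holo1[OF A(4-6)] \<phi>1_nz
    by (intro holomorphic_on_divide) (auto simp: g1_def[abs_def] \<phi>1_def[abs_def])
  then obtain l where l: "l holomorphic_on unit_disk" "l 0 = 0"
    "\<And>z. z \<in> unit_disk \<Longrightarrow> exp (l z) = g1 z / \<phi>1 z"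
    using normalised_log_exists[of "\<lambda>z. g1 z / \<phi>1 z"] g1_nz \<phi>1_nz by (auto simp: g1_def \<phi>1_def)
  show ?thesis
  proof
    show "exp (l z) = class_quot g \<phi> z" if "z \<in> unit_disk" for z
      using l(3) quot that by simp
    show "z_log_deriv g z - z_log_deriv \<phi> z = z * deriv l z" if z: "z \<in> unit_disk" for z
    proof (cases "z = 0")
      case True then show ?thesis by (simp add: z_log_deriv_def)
    next
      case False
      have g_eq: "g w = \<phi> w * exp (l w)" if "w \<in> unit_disk" for w
        using l(3)[OF that] \<phi>_nz[of w] that A(2,5) by (cases "w = 0") (auto simp: g1_def \<phi>1_def)
      have "((\<lambda>w. \<phi> w * exp (l w)) has_field_derivative
          deriv \<phi> z * exp (l z) + exp (l z) * deriv l z * \<phi> z) (at z)"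
        by (intro DERIV_mult DERIV_chain2[OF DERIV_exp] holomorphic_derivI[OF _ open_ball z] A(4) l(1))
      then have "(g has_field_derivative deriv \<phi> z * exp (l z) + exp (l z) * deriv l z * \<phi> z) (at z)"
        by (rule has_field_derivative_transform_within_open[OF _ open_ball z]) (simp add: g_eq)
      then have "deriv g z = deriv \<phi> z * exp (l z) + exp (l z) * deriv l z * \<phi> z"
        by (rule DERIV_imp_deriv)
      then have "deriv g z / g z = deriv \<phi> z / \<phi> z + deriv l z"
        using \<phi>_nz[of z] z False by (simp add: g_eq[OF z] field_simps)
      then show ?thesis
        using False by (simp add: z_log_deriv_def algebra_simps flip: times_divide_eq_right)
    qed
  qed (rule l)+
qed

section \<open>The univalence criterion\<close>

theorem theorem3p2:
  fixes f g \<phi> :: "complex \<Rightarrow> complex" and \<alpha> \<beta> \<gamma> :: complex and m :: real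
  assumes "f \<in> class_A" and "g \<in> class_A" and "\<phi> \<in> class_A"
    and "\<And>z. z \<in> unit_disk - {0} \<Longrightarrow> g z \<noteq> 0"
    and "\<And>z. z \<in> unit_disk - {0} \<Longrightarrow> \<phi> z \<noteq> 0"
    and "Re \<gamma> > 0"
    and "m > 0" and "m \<ge> 1"
    and "\<And>z. z \<in> unit_disk \<Longrightarrow>
      (1 - norm z powr ((m + 1) * Re \<gamma>)) / Re \<gamma> *
        norm (\<alpha> * (z * deriv (deriv f) z / deriv f z)
              + \<beta> * (z_log_deriv g z - z_log_deriv \<phi> z)) \<le> 1"
  shows "\<exists>F. F analytic_on unit_disk \<and> inj_on F unit_disk
    \<and> (\<forall>\<^sub>F z in nhds 0. F z = op_F f g \<phi> \<alpha> \<beta> \<gamma> z)"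
proof -
  note \<gamma> = \<open>Re \<gamma> > 0\<close> and m = \<open>m \<ge> 1\<close>
  define P where "P = deriv f"
  have P: "P holomorphic_on unit_disk" "P 0 = 1"
    using assms(1) by (auto simp: P_def class_A_def analytic_on_open intro: holomorphic_deriv)
  obtain lq where lq: "lq holomorphic_on unit_disk" "lq 0 = 0"
    "\<And>z. z \<in> unit_disk \<Longrightarrow> exp (lq z) = class_quot g \<phi> z"
    "\<And>z. z \<in> unit_disk \<Longrightarrow> z_log_deriv g z - z_log_deriv \<phi> z = z * deriv lq z"
    using log_class_quot_exists[OF assms(2-5)] by blast
  define c where "c z = (1 - norm z powr ((m + 1) * Re \<gamma>)) / Re \<gamma>" for z :: complex
  have bound: "c z * norm (\<alpha> * z * (deriv P z / P z) + \<beta> * z * deriv lq z) \<le> 1" if "z \<in> unit_disk" for z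
    using assms(9)[OF that] lq(4)[OF that] by (simp add: c_def P_def mult.assoc)
  have c_pos: "c z > 0" if "z \<in> unit_disk" for z
  proof -
    have "norm z powr ((m + 1) * Re \<gamma>) < 1 powr ((m + 1) * Re \<gamma>)"
      using that \<gamma> m by (intro powr_less_mono2) auto
    then show ?thesis using \<gamma> by (simp add: c_def)
  qed
  \<comment> \<open>For \<open>\<alpha> = 0\<close> the derivative may vanish in the disk, which is why \<open>lf\<close> is chosen to be 0 in that case.\<close>
  have P_nz: "P z \<noteq> 0" if "\<alpha> \<noteq> 0" "z \<in> unit_disk" for z
  proof
    assume "P z = 0"
    then have "z \<noteq> 0" using P(2) by auto
    have "\<not> P constant_on unit_disk"
      using \<open>P z = 0\<close> P(2) that(2) unfolding constant_on_def
      by (metis centre_in_ball zero_less_one zero_neq_one)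
    moreover have "continuous_on unit_disk c"
      unfolding c_def using \<gamma> m by (intro continuous_intros continuous_on_powr') auto
    moreover have "continuous_on unit_disk (\<lambda>z. \<alpha> * z)"
      "continuous_on unit_disk (\<lambda>z. \<beta> * z * deriv lq z)"
      by (intro continuous_intros holomorphic_on_imp_continuous_on holomorphic_deriv lq open_ball)+
    ultimately have "P z \<noteq> 0"
      using zero_free_of_bounded_log_derivative[of P unit_disk "\<lambda>z. \<alpha> * z" "\<lambda>z. \<beta> * z * deriv lq z" c z]
        P(1) bound c_pos that \<open>z \<noteq> 0\<close>
      by auto
    then show False using \<open>P z = 0\<close> by simp
  qed
  obtain lf where lf: "lf holomorphic_on unit_disk" "lf 0 = 0"
    "\<And>z. \<alpha> \<noteq> 0 \<Longrightarrow> z \<in> unit_disk \<Longrightarrow> exp (lf z) = P z"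
  proof (cases "\<alpha> = 0")
    case True
    then show ?thesis using that[of "\<lambda>_. 0"] by simp
  next
    case False
    then show ?thesis using normalised_log_exists[OF P(1) P_nz P(2)] that by metis
  qed
  define h where "h z = exp (\<alpha> * lf z + \<beta> * lq z)" for z
  have h: "h holomorphic_on unit_disk"
    unfolding h_def by (intro holomorphic_intros lf lq)
  obtain H where H: "H holomorphic_on unit_disk"
    "\<And>z. z \<in> unit_disk \<Longrightarrow> z * deriv H z + \<gamma> * H z = \<gamma> * h z"
    using Euler_equation_solution_exists[OF h \<gamma>] by blast
  interpret damped_Euler_pair h H \<gamma>
  proof
    fix z assume z: "z \<in> unit_disk"
    have "(h has_field_derivative h z * (\<alpha> * deriv lf z + \<beta> * deriv lq z)) (at z)"
      unfolding h_def
      by (intro DERIV_chain2[OF DERIV_exp] DERIV_add DERIV_cmult holomorphic_derivI[OF _ open_ball z] lf lq)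
    then have "deriv h z = h z * (\<alpha> * deriv lf z + \<beta> * deriv lq z)"
      by (rule DERIV_imp_deriv)
    moreover have "\<alpha> * deriv lf z = \<alpha> * (deriv P z / P z)"
      using deriv_eq_log_deriv[OF lf(1) lf(3) z] by (cases "\<alpha> = 0") auto
    ultimately have "z * deriv h z = h z * (\<alpha> * z * (deriv P z / P z) + \<beta> * z * deriv lq z)"
      by (simp add: algebra_simps)
    then have dh: "norm (z * deriv h z) =
        norm (h z) * norm (\<alpha> * z * (deriv P z / P z) + \<beta> * z * deriv lq z)"
      by (simp only: norm_mult)
    \<comment> \<open>The hypothesis is stronger for larger \<open>m\<close>, so it implies the damping condition.\<close>
    have "norm z powr ((m + 1) * Re \<gamma>) \<le> norm z powr (2 * Re \<gamma>)"
      using z \<gamma> m by (intro powr_mono') auto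
    then have "1 - norm z powr (2 * Re \<gamma>) \<le> Re \<gamma> * c z"
      using \<gamma> by (simp add: c_def)
    then have "(1 - norm z powr (2 * Re \<gamma>)) * norm (z * deriv h z) \<le> Re \<gamma> * c z * norm (z * deriv h z)"
      by (rule mult_right_mono) simp
    also have "\<dots> = Re \<gamma> * norm (h z) * (c z * norm (\<alpha> * z * (deriv P z / P z) + \<beta> * z * deriv lq z))"
      unfolding dh by (simp only: mult_ac)
    also have "\<dots> \<le> Re \<gamma> * norm (h z) * 1"
      using bound[OF z] \<gamma> by (intro mult_left_mono) auto
    finally show "(1 - norm z powr (2 * Re \<gamma>)) * norm (z * deriv h z) \<le> Re \<gamma> * norm (h z)"
      by simp
  qed (use h H \<gamma> lf(2) lq(2) in \<open>auto simp: h_def\<close>)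
  obtain \<Lambda> where \<Lambda>: "\<Lambda> holomorphic_on unit_disk" "\<Lambda> 0 = 0" "\<And>z. z \<in> unit_disk \<Longrightarrow> exp (\<Lambda> z) = H z"
    "inj_on (\<lambda>z. z * exp (\<Lambda> z / \<gamma>)) unit_disk"
    using univalent_root by blast
  have "\<forall>\<^sub>F z in nhds 0. z \<in> unit_disk"
    by (rule eventually_nhds_in_open) auto
  note near_0 = this eventually_powr_exp[OF lf(1,2), of \<alpha>] eventually_powr_exp[OF lq(1,2), of \<beta>]
  have "\<forall>\<^sub>F z in nhds 0. P z \<noteq> 0"
  proof -
    have "isCont P 0"
      using continuous_on_interior[OF holomorphic_on_imp_continuous_on[OF P(1)], of 0]
      by (simp add: interior_open)
    then have "(P \<longlongrightarrow> P 0) (nhds 0)"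
      unfolding isCont_def tendsto_at_iff_tendsto_nhds .
    then show ?thesis by (rule tendsto_imp_eventually_ne) (simp add: P(2))
  qed
  then have "\<forall>\<^sub>F z in nhds 0. z \<in> unit_disk \<and> integrand_h f g \<phi> \<alpha> \<beta> z = h z"
    using near_0
  proof eventually_elim
    case (elim z)
    have "P z powr \<alpha> = exp (\<alpha> * lf z)"
      using elim lf(3)[of z] by (cases "\<alpha> = 0") auto
    then show ?case
      using elim lq(3)[of z] by (simp add: integrand_h_def P_def[symmetric] h_def exp_add)
  qed
  then obtain \<rho> where \<rho>: "\<rho> > 0" "\<And>z. norm z < \<rho> \<Longrightarrow> z \<in> unit_disk \<and> integrand_h f g \<phi> \<alpha> \<beta> z = h z"
    unfolding eventually_nhds_metric by auto
  have h2: "op_h2 f g \<phi> \<alpha> \<beta> \<gamma> z = H z" if z: "norm z < \<rho>" for z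
  proof -
    have "integral {0..1} (\<lambda>t::real. of_real t powr (\<gamma> - 1) * integrand_h f g \<phi> \<alpha> \<beta> (of_real t * z))
        = integral {0..1} (\<lambda>t::real. of_real t powr (\<gamma> - 1) * h (of_real t * z))"
    proof (rule integral_cong)
      fix t :: real assume "t \<in> {0..1}"
      then have "norm (of_real t * z) < \<rho>"
        using mult_left_le_one_le[of "norm z" t] z by (simp add: norm_mult)
      then show "of_real t powr (\<gamma> - 1) * integrand_h f g \<phi> \<alpha> \<beta> (of_real t * z)
          = of_real t powr (\<gamma> - 1) * h (of_real t * z)"
        using \<rho>(2) by simp
    qed
    then show ?thesis
      unfolding op_h2_def using integral_eq_Euler_solution[OF H(1) \<gamma> H(2), of z] \<rho>(2)[OF z] by simp
  qed
  have "\<forall>\<^sub>F z::complex in nhds 0. norm z < \<rho>"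
    using eventually_nhds_in_open[of "ball 0 \<rho>" "0::complex"] \<rho>(1) by simp
  then have "\<forall>\<^sub>F z in nhds 0. z * exp (\<Lambda> z / \<gamma>) = op_F f g \<phi> \<alpha> \<beta> \<gamma> z"
    using eventually_powr_exp[OF \<Lambda>(1,2), of "1 / \<gamma>"]
  proof eventually_elim
    case (elim z)
    then show ?case
      using \<Lambda>(3)[of z] \<rho>(2)[of z] by (simp add: op_F_def h2)
  qed
  moreover have "(\<lambda>z. z * exp (\<Lambda> z / \<gamma>)) analytic_on unit_disk"
    unfolding analytic_on_open[OF open_ball] using gamma_nz
    by (intro holomorphic_intros \<Lambda>(1)) auto
  ultimately show ?thesis using \<Lambda>(4) by blast
qed

end
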